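(* The equation \[ 3\,e^{-\frac{2p(1-p)}{(2-p)^2}}=4-2p \] has a unique root $p_{\mathsf c}$ in $[0,1]$, with $p_{\mathsf c}\approx 0.799$. Suppose that $m,n\to\infty$ (with $m=m(n)$, $0\le m\le\binom n2$) in such a way that $m/\binom n2\to p\in(0,1]$. If $n$ is large enough, then for any distinct vertices $s,a,b$ of the random directed graph $\vec G(n,m)$: (i) if $0<p<p_{\mathsf c}$, then $\operatorname{Cov}(s\not\to a,\ b\not\to s)<0$; (ii) if $p_{\mathsf c}<p\le 1$, then $\operatorname{Cov}(s\not\to a,\ b\not\to s)>0$.
   Context: For $0\le m\le \binom n2$, $G(n,m)$ is the random graph with $n$ labelled vertices $1,\dots,n$ and $m$ edges, uniformly chosen among all such graphs. $\vec G(n,m)$ is the random directed graph obtained from $G(n,m)$ by giving each edge one of its two orientations with probability $1/2$ each, independently of everything else. All probabilities are in the combined (annealed) probability space of the random graph and the orientations. For vertices $u,v$, $\{u\to v\}$ is the event that there is a directed path from $u$ to $v$, and $\{u\not\to v\}$ is its complement. For events $A,B$, $\operatorname{Cov}(A,B):=\mathbb P(A\cap B)-\mathbb P(A)\mathbb P(B)$. *)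

theory Defs
  imports "HOL-Probability.Probability"
begin

definition all_edges :: "nat \<Rightarrow> nat set set" where
  "all_edges n = {e. e \<subseteq> {1..n} \<and> card e = 2}"

definition gnm :: "nat \<Rightarrow> nat \<Rightarrow> nat set set pmf" where
  "gnm n m = pmf_of_set {E. E \<subseteq> all_edges n \<and> card E = m}"

definition edge_orientations :: "nat set \<Rightarrow> (nat \<times> nat) set" where
  "edge_orientations e = {(u, v). {u, v} = e}"

(* A digraph on {1..n} is represented by its set of arcs. Pi_pmf E orients the edges of E
   independently; its default value undefined is only taken outside E and hence never used. *)
definition directed_gnm :: "nat \<Rightarrow> nat \<Rightarrow> (nat \<times> nat) set pmf" where
  "directed_gnm n m =
     gnm n m \<bind> (\<lambda>E.
       Pi_pmf E undefined (\<lambda>e. pmf_of_set (edge_orientations e)) \<bind> (\<lambda>f.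
         return_pmf (f ` E)))"

definition path_event :: "nat \<Rightarrow> nat \<Rightarrow> (nat \<times> nat) set set" where
  "path_event u v = {D. (u, v) \<in> D\<^sup>*}"

definition no_path_event :: "nat \<Rightarrow> nat \<Rightarrow> (nat \<times> nat) set set" where
  "no_path_event u v = - path_event u v"

definition event_cov :: "'a pmf \<Rightarrow> 'a set \<Rightarrow> 'a set \<Rightarrow> real" where
  "event_cov M A B =
     measure_pmf.prob M (A \<inter> B) - measure_pmf.prob M A * measure_pmf.prob M B"

definition critical_eq :: "real \<Rightarrow> bool" where
  "critical_eq p \<longleftrightarrow> 3 * exp (- (2 * p * (1 - p) / (2 - p)\<^sup>2)) = 4 - 2 * p"

definition p_crit :: real where
  "p_crit = (THE p. p \<in> {0..1} \<and> critical_eq p)"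

end

theory Submission
  imports Defs "HOL-Computational_Algebra.Polynomial" "HOL-Real_Asymp.Real_Asymp"
begin

text \<open>
  Why the covariance changes sign at \<open>p_crit\<close>. Put \<open>N = n choose 2\<close>, \<open>q = m / N\<close> and \<open>r = 1 - q/2\<close>. A
  path from \<open>s\<close> to \<open>a\<close> is missing iff some set of vertices containing \<open>s\<close> but not \<open>a\<close> has no outgoing arc.
  For a set of \<open>k\<close> vertices this forbids one orientation of each of \<open>k * (n - k)\<close> slots (a slot is a
  pair of vertices) and costs about \<open>r\<close> for each slot, so the sets with \<open>k = 1\<close> and \<open>k = n - 1\<close> dominate:
  typically \<open>s\<close> is a sink or \<open>a\<close> is a source. Hence the probability of the event is asymptotic to
  \<open>2 * F (n - 1)\<close>, where \<open>F K\<close> (\<open>one_way_prob\<close>) is the probability that \<open>K\<close> given slots all avoid a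
  prescribed orientation.

  For the joint event three configurations dominate. In the first, \<open>b\<close> is a sink and \<open>s\<close> has no outgoing
  arc except possibly one to \<open>b\<close>; the second is its mirror image with \<open>a\<close> a source and \<open>s\<close> having no
  incoming arc except possibly one from \<open>a\<close>; in the third, \<open>a\<close> is a source and \<open>b\<close> a sink. Each forbids
  one orientation of \<open>2 * n - 3\<close> slots, so the joint probability is asymptotic to \<open>3 * F (2 * n - 3)\<close>, and
  the sign of the covariance is that of the limit of \<open>3 * F (2 * n - 3) / F (n - 1)^2 - 4\<close>.

  With independent edges \<open>F K\<close> would be \<open>r^K\<close> and the quotient \<open>1 / r\<close>. The fixed number of edges adds
  the factor \<open>exp (- (2 * p * (1 - p) / (2 - p)^2))\<close>. It is obtained from a three-term recurrence for \<open>F\<close>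
  (\<open>one_way_prob_recurrence\<close>), which determines the ratios \<open>F (K + 1) / F K\<close> up to \<open>o(1/n)\<close> uniformly
  in \<open>K \<le> 2 * n\<close>; see \<open>F_ratio_tendsto\<close>. The resulting condition is the critical equation, whose two sides
  differ by a strictly increasing function.

  The remaining work is to show that nothing else matters. The main tool is the comparison with
  independent edges in \<open>coeff_weight_poly_le_prod\<close>: the probability of avoiding a set of arcs is at most
  \<open>r\<close> to the number of arcs. The combinatorial case distinction is \<open>no_path_events_subset\<close>. The only error
  term that arc counting does not settle is that \<open>s\<close> is isolated, see \<open>prob_isolated_le\<close>.
\<close>

section \<open>Weighted sums over sets of fixed size\<close>


text \<open>
  The coefficient of \<open>x^m\<close> is the elementary symmetric polynomial of degree \<open>m\<close> in the
  weights. Products over a uniform random \<open>m\<close>-set are therefore coefficients of such polynomials.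
\<close>
definition weight_poly :: "'a set \<Rightarrow> ('a \<Rightarrow> real) \<Rightarrow> real poly" where
  "weight_poly S w = (\<Prod>e\<in>S. [:1, w e:])"

lemma weight_poly_remove:
  assumes "finite S" "e \<in> S"
  shows "weight_poly S w = [:1, w e:] * weight_poly (S - {e}) w"
  unfolding weight_poly_def using assms by (subst prod.remove[of _ e]) auto

lemma weight_poly_cong:
  "(\<And>e. e \<in> S \<Longrightarrow> w e = w' e) \<Longrightarrow> weight_poly S w = weight_poly S w'"
  unfolding weight_poly_def by (rule prod.cong) auto

lemma coeff_linear_factor_mult:
  "coeff ([:1, c:] * q) m = coeff q m + (c::real) * (if m = 0 then 0 else coeff q (m - 1))"
  by (cases m) (auto simp: mult_pCons_left)

lemma sum_subsets_eq_coeff_weight_poly: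
  fixes S :: "'a set"
  assumes "finite S"
  shows "(\<Sum>E | E \<subseteq> S \<and> card E = m. \<Prod>e\<in>E. w e) = coeff (weight_poly S w) m"
  using assms
proof (induction S arbitrary: m rule: finite_induct)
  case empty
  have "{E. E \<subseteq> ({} :: 'a set) \<and> card E = m} = (if m = 0 then {{}} else {})" by auto
  then have "(\<Sum>E | E \<subseteq> ({} :: 'a set) \<and> card E = m. \<Prod>e\<in>E. w e) = (if m = 0 then 1 else 0)"
    by (simp only:) simp
  then show ?case by (simp only:) (simp add: weight_poly_def)
next
  case (insert x S)
  have poly: "weight_poly (insert x S) w = [:1, w x:] * weight_poly S w"
    using insert by (simp add: weight_poly_def)
  have split: "{E. E \<subseteq> insert x S \<and> card E = m} =
      {E. E \<subseteq> S \<and> card E = m} \<union> insert x ` {E. E \<subseteq> S \<and> Suc (card E) = m}" (is "?L = ?A \<union> ?B")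
  proof
    show "?L \<subseteq> ?A \<union> ?B"
    proof
      fix E assume E: "E \<in> ?L"
      show "E \<in> ?A \<union> ?B"
      proof (cases "x \<in> E")
        case True
        moreover have "finite E" using E insert finite_subset[of E "insert x S"] by auto
        ultimately have "Suc (card (E - {x})) = card E" by (metis card.remove)
        then have "E = insert x (E - {x})" "E - {x} \<subseteq> S" "Suc (card (E - {x})) = m"
          using E True by auto
        then show ?thesis by blast
      qed (use E in auto)
    qed
    show "?A \<union> ?B \<subseteq> ?L"
      using insert by (auto simp: card_insert_if finite_subset)
  qed
  have "(\<Sum>E\<in>?L. \<Prod>e\<in>E. w e) = (\<Sum>E\<in>?A. \<Prod>e\<in>E. w e) + (\<Sum>E\<in>?B. \<Prod>e\<in>E. w e)"
    unfolding split using insert by (intro sum.union_disjoint) auto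
  also have "(\<Sum>E\<in>?B. \<Prod>e\<in>E. w e) = (\<Sum>E | E \<subseteq> S \<and> Suc (card E) = m. w x * (\<Prod>e\<in>E. w e))"
  proof -
    have "inj_on (insert x) {E. E \<subseteq> S \<and> Suc (card E) = m}"
    proof (rule inj_onI)
      fix A B assume "A \<in> {E. E \<subseteq> S \<and> Suc (card E) = m}" "B \<in> {E. E \<subseteq> S \<and> Suc (card E) = m}"
        and eq: "insert x A = insert x B"
      then have "x \<notin> A" "x \<notin> B" using insert by auto
      with eq show "A = B" by (simp add: insert_ident)
    qed
    moreover have "prod w (insert x E) = w x * prod w E" if "E \<subseteq> S" for E
      using that insert finite_subset[of E S] by (subst prod.insert) auto
    ultimately show ?thesis by (subst sum.reindex) (auto intro!: sum.cong)
  qed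
  also have "\<dots> = w x * (if m = 0 then 0 else coeff (weight_poly S w) (m - 1))"
    using insert.IH[of "m - 1"] by (cases m) (auto simp: sum_distrib_left[symmetric])
  finally show ?case
    by (simp only: poly coeff_linear_factor_mult insert.IH)
qed

lemma coeff_weight_poly_nonneg:
  assumes "finite S" "\<And>e. e \<in> S \<Longrightarrow> 0 \<le> w e"
  shows "0 \<le> coeff (weight_poly S w) m"
  unfolding sum_subsets_eq_coeff_weight_poly[OF assms(1), symmetric]
  using assms(2) by (intro sum_nonneg prod_nonneg) auto

text \<open>
  Euler's relation for elementary symmetric polynomials: each \<open>m\<close>-set arises \<open>m\<close> times by
  adjoining one of its elements to the rest. On generating functions this is the product rule.
\<close>
lemma coeff_weight_poly_double_count:
  assumes "finite S" "m > 0"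
  shows "real m * coeff (weight_poly S w) m = (\<Sum>f\<in>S. w f * coeff (weight_poly (S - {f}) w) (m - 1))"
proof -
  obtain k where k: "m = Suc k" using assms(2) by (cases m) auto
  have "pderiv (weight_poly S w) = (\<Sum>f\<in>S. weight_poly (S - {f}) w * [:w f:])"
    unfolding weight_poly_def by (subst pderiv_prod) (auto simp: pderiv_pCons)
  then have "coeff (pderiv (weight_poly S w)) k = (\<Sum>f\<in>S. coeff (weight_poly (S - {f}) w * [:w f:]) k)"
    by (simp add: coeff_sum)
  then show ?thesis by (simp add: k coeff_pderiv)
qed

text \<open>
  Choose an \<open>m\<close>-subset of \<open>S\<close> with probability proportional to the product of its weights.
  The average probability of being chosen is \<open>m / card S\<close>, and exchanging any \<open>f\<close> for an element \<open>e\<close>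
  of maximal weight 1 does not decrease the product, so \<open>e\<close> is chosen with at least average probability.
\<close>
lemma coeff_weight_poly_heaviest:
  assumes S: "finite S" "e \<in> S" and w: "\<And>f. f \<in> S \<Longrightarrow> 0 \<le> w f" "\<And>f. f \<in> S \<Longrightarrow> w f \<le> 1"
    and we: "w e = 1" and m: "m > 0"
  shows "real m * coeff (weight_poly S w) m \<le> card S * coeff (weight_poly (S - {e}) w) (m - 1)"
proof -
  have "w f * coeff (weight_poly (S - {f}) w) (m - 1) \<le> coeff (weight_poly (S - {e}) w) (m - 1)"
    if f: "f \<in> S" for f
  proof (cases "f = e")
    case False
    let ?c = "\<lambda>k. coeff (weight_poly (S - {e} - {f}) w) k"
    have "w f * coeff (weight_poly (S - {f}) w) (m - 1) =
        w f * ?c (m - 1) + w f * (if m - 1 = 0 then 0 else ?c (m - 1 - 1))"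
      using S f False we
      by (subst weight_poly_remove[of _ e], simp, simp, subst coeff_linear_factor_mult)
         (auto simp: algebra_simps Diff_insert[symmetric] insert_commute)
    also have "\<dots> \<le> 1 * ?c (m - 1) + w f * (if m - 1 = 0 then 0 else ?c (m - 1 - 1))"
      using S w f by (intro add_right_mono mult_right_mono coeff_weight_poly_nonneg) auto
    also have "\<dots> = coeff (weight_poly (S - {e}) w) (m - 1)"
      using S f False by (subst (2) weight_poly_remove[of _ f], simp, simp, subst coeff_linear_factor_mult) simp
    finally show ?thesis .
  qed (simp add: we)
  then have "(\<Sum>f\<in>S. w f * coeff (weight_poly (S - {f}) w) (m - 1))
      \<le> (\<Sum>f\<in>S. coeff (weight_poly (S - {e}) w) (m - 1))"
    by (intro sum_mono)
  then show ?thesis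
    using coeff_weight_poly_double_count[OF S(1) m, of w] by simp
qed

lemma coeff_weight_poly_one:
  "finite S \<Longrightarrow> coeff (weight_poly S (\<lambda>_. 1)) m = card S choose m"
  by (subst sum_subsets_eq_coeff_weight_poly[symmetric]) (simp_all add: n_subsets)

text \<open>
  A negative dependence inequality: for weights in the unit interval, the expected product over a
  uniform \<open>m\<close>-set is at most what it would be if the elements were chosen independently, each with
  probability \<open>q = m / card S\<close>. The weights are lowered from 1 one at a time. Lowering the weight of \<open>e\<close>
  multiplies the sum by 1 minus \<open>1 - w e\<close> times the probability of choosing \<open>e\<close> under the old
  weights, and this probability is at least \<open>q\<close> because \<open>e\<close> still had the maximal weight.
\<close>
lemma coeff_weight_poly_le_prod:
  assumes S: "finite S" and w: "\<And>f. f \<in> S \<Longrightarrow> 0 \<le> w f" "\<And>f. f \<in> S \<Longrightarrow> w f \<le> 1"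
    and m: "m \<le> card S"
  shows "coeff (weight_poly S w) m \<le> (card S choose m) * (\<Prod>e\<in>S. 1 - real m / card S * (1 - w e))"
proof (cases "m = 0")
  case True
  then show ?thesis using S
    by (simp add: weight_poly_def poly_0_coeff_0[symmetric] poly_prod)
next
  case False
  define q where "q = real m / card S"
  have q: "q \<le> 1" "q \<ge> 0" using m by (auto simp: q_def divide_simps)
  \<comment> \<open>the weights on a growing subset T are already lowered\<close>
  have "coeff (weight_poly S (\<lambda>e. if e \<in> T then w e else 1)) m
      \<le> (card S choose m) * (\<Prod>e\<in>T. 1 - q * (1 - w e))" if "T \<subseteq> S" for T
    using finite_subset[OF that S] that
  proof (induction T rule: finite_induct)
    case empty
    then show ?case using S by (simp add: coeff_weight_poly_one)
  next
    case (insert e T)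
    let ?v = "\<lambda>f. if f \<in> T then w f else 1"
    let ?Q = "coeff (weight_poly (S - {e}) ?v)"
    have new: "coeff (weight_poly S (\<lambda>f. if f \<in> insert e T then w f else 1)) m = ?Q m + w e * ?Q (m - 1)"
    proof -
      have "weight_poly (S - {e}) (\<lambda>f. if f \<in> insert e T then w f else 1) = weight_poly (S - {e}) ?v"
        by (rule weight_poly_cong) auto
      then show ?thesis
        using S insert False
        by (subst weight_poly_remove[of _ e], simp, simp, simp only: coeff_linear_factor_mult) simp
    qed
    have old: "coeff (weight_poly S ?v) m = ?Q m + ?Q (m - 1)"
      using S insert False
      by (subst weight_poly_remove[of _ e], simp, simp, subst coeff_linear_factor_mult) auto
    have "real m * coeff (weight_poly S ?v) m \<le> card S * ?Q (m - 1)"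
      using S w insert False by (intro coeff_weight_poly_heaviest) auto
    then have "q * coeff (weight_poly S ?v) m \<le> ?Q (m - 1)"
      using False m by (simp add: q_def field_simps)
    then have "(1 - w e) * (q * coeff (weight_poly S ?v) m) \<le> (1 - w e) * ?Q (m - 1)"
      using w insert by (intro mult_left_mono) auto
    then have "?Q m + w e * ?Q (m - 1) \<le> (1 - q * (1 - w e)) * coeff (weight_poly S ?v) m"
      unfolding old by (simp add: algebra_simps)
    also have "\<dots> \<le> (1 - q * (1 - w e)) * ((card S choose m) * (\<Prod>e\<in>T. 1 - q * (1 - w e)))"
      using insert q w by (intro mult_left_mono) (auto simp: mult_le_one)
    finally show ?case
      unfolding new using insert by (simp add: algebra_simps)
  qed
  from this[of S] show ?thesis
    by (simp add: q_def cong: weight_poly_cong)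
qed

section \<open>Avoiding one orientation of each of K slots\<close>


text \<open>
  The generating function for \<open>N\<close> slots of which \<open>K\<close> have weight one half.
\<close>
definition half_poly :: "nat \<Rightarrow> nat \<Rightarrow> real poly" where
  "half_poly N K = [:1, 1/2:] ^ K * [:1, 1:] ^ (N - K)"

text \<open>
  If \<open>m\<close> of \<open>N\<close> slots are occupied at random by randomly oriented edges, this is the probability
  that none of \<open>K\<close> prescribed slots carries an edge in its forbidden orientation.
\<close>
definition one_way_prob :: "nat \<Rightarrow> nat \<Rightarrow> nat \<Rightarrow> real" where
  "one_way_prob N m K = coeff (half_poly N K) m / (N choose m)"

lemma weight_poly_halves:
  assumes "finite S" "T \<subseteq> S" "\<And>e. e \<in> T \<Longrightarrow> w e = 1/2" "\<And>e. e \<in> S - T \<Longrightarrow> w e = 1"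
  shows "weight_poly S w = half_poly (card S) (card T)"
proof -
  have "weight_poly S w = weight_poly (S - T) w * weight_poly T w"
    unfolding weight_poly_def by (rule prod.subset_diff[OF assms(2,1)])
  also have "weight_poly T w = (\<Prod>e\<in>T. [:1, 1/2:])"
    unfolding weight_poly_def using assms(3) by (intro prod.cong) auto
  also have "weight_poly (S - T) w = (\<Prod>e\<in>S - T. [:1, 1:])"
    unfolding weight_poly_def using assms(4) by (intro prod.cong) auto
  finally show ?thesis
    using assms(1,2) by (simp add: half_poly_def card_Diff_subset finite_subset mult.commute)
qed

lemma half_poly_eq_weight_poly:
  "K \<le> N \<Longrightarrow> half_poly N K = weight_poly {..<N} (\<lambda>i. if i < K then 1/2 else 1)"
  by (subst weight_poly_halves[of _ "{..<K}"]) auto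

lemma coeff_half_poly_pos:
  assumes "K \<le> N" "m \<le> N"
  shows "coeff (half_poly N K) m > 0"
  unfolding half_poly_eq_weight_poly[OF assms(1)]
  by (subst sum_subsets_eq_coeff_weight_poly[symmetric], simp, rule sum_pos)
     (use assms in \<open>auto intro!: prod_pos exI[of _ "{..<m}"]\<close>)

lemma one_way_prob_pos: "K \<le> N \<Longrightarrow> m \<le> N \<Longrightarrow> one_way_prob N m K > 0"
  by (simp add: one_way_prob_def coeff_half_poly_pos)

lemma one_way_prob_0: "m \<le> N \<Longrightarrow> one_way_prob N m 0 = 1"
  by (simp add: one_way_prob_def half_poly_eq_weight_poly coeff_weight_poly_one)

text \<open>
  A slot on which nothing is forbidden is occupied with conditional probability at least \<open>m / N\<close>, by
  \<open>coeff_weight_poly_heaviest\<close>.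
\<close>
lemma one_way_prob_Suc_le:
  assumes K: "K < N" and m: "m \<le> N"
  shows "one_way_prob N m (Suc K) \<le> (1 - m / (2 * N)) * one_way_prob N m K"
proof (cases "m = 0")
  case True
  then show ?thesis
    by (simp add: one_way_prob_def half_poly_def poly_0_coeff_0[symmetric])
next
  case False
  let ?w = "\<lambda>i. if i < K then 1/2 else (1::real)"
  let ?Q = "coeff (weight_poly ({..<N} - {K}) ?w)"
  have old: "coeff (half_poly N K) m = ?Q m + ?Q (m - 1)"
    using K False unfolding half_poly_eq_weight_poly[OF less_imp_le[OF K]]
    by (subst weight_poly_remove[of _ K], simp, simp, subst coeff_linear_factor_mult) auto
  have "half_poly N (Suc K) = [:1, 1/2:] * weight_poly ({..<N} - {K}) (\<lambda>i. if i < Suc K then 1/2 else 1)"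
    using K by (subst half_poly_eq_weight_poly, simp, subst weight_poly_remove[of _ K]) auto
  also have "weight_poly ({..<N} - {K}) (\<lambda>i. if i < Suc K then 1/2 else 1) = weight_poly ({..<N} - {K}) ?w"
    by (rule weight_poly_cong) auto
  finally have new: "coeff (half_poly N (Suc K)) m = ?Q m + ?Q (m - 1) / 2"
    using False by (simp only: coeff_linear_factor_mult) simp
  have "real m * coeff (half_poly N K) m \<le> N * ?Q (m - 1)"
    unfolding half_poly_eq_weight_poly[OF less_imp_le[OF K]]
    using coeff_weight_poly_heaviest[of "{..<N}" K ?w m] K False by simp
  then have "m / (2 * N) * coeff (half_poly N K) m \<le> ?Q (m - 1) / 2"
    using K by (simp add: field_simps)
  then have "coeff (half_poly N (Suc K)) m \<le> (1 - m / (2 * N)) * coeff (half_poly N K) m"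
    unfolding new left_diff_distrib using old by linarith
  then show ?thesis
    unfolding one_way_prob_def times_divide_eq_right of_nat_mult of_nat_numeral
    by (rule divide_right_mono) simp
qed

text \<open>
  The linear recurrence that makes precise asymptotics possible. It is the coefficient form of a
  differential equation: \<open>X\<close> times the derivative of \<open>A^K * B^(N-K)\<close>, with \<open>A = 1 + X/2\<close> and
  \<open>B = 1 + X\<close>, is a combination of the generating functions for \<open>K - 1\<close>, \<open>K\<close> and \<open>K + 1\<close>, since
  \<open>X = 2 * (B - A)\<close>.
\<close>
lemma one_way_prob_recurrence:
  assumes K: "K < N"
  shows "real m * one_way_prob N m K =
      real K * (one_way_prob N m (K - 1) - one_way_prob N m K)
      + 2 * real (N - K) * (one_way_prob N m K - one_way_prob N m (Suc K))"
proof -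
  define A B X :: "real poly" where "A = [:1, 1/2:]" and "B = [:1, 1:]" and "X = [:0, 1:]"
  have smult: "smult (of_nat i) P = of_nat i * P" for i and P :: "real poly"
    by (simp add: of_nat_poly)
  have X: "X = 2 * (B - A)" by (simp add: A_def B_def X_def numeral_poly)
  have XA: "X * pderiv (A ^ i) = of_nat i * (A ^ (i - 1) * B - A ^ i)" for i
  proof (cases i)
    case (Suc j)
    have "pderiv A = [:1/2:]" by (simp add: A_def pderiv_pCons)
    moreover have "X * [:1/2:] = B - A" by (simp add: A_def B_def X_def)
    ultimately have "X * pderiv (A ^ i) = of_nat i * (A ^ j * (B - A))"
      by (simp only: Suc pderiv_power_Suc smult mult.assoc mult.left_commute[of X])
    then show ?thesis using Suc by (simp add: algebra_simps)
  qed simp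
  have XB: "X * pderiv (B ^ i) = of_nat i * (2 * (B ^ i - A * B ^ (i - 1)))" for i
  proof (cases i)
    case (Suc j)
    have "pderiv B = 1" by (simp add: B_def pderiv_pCons)
    then have "X * pderiv (B ^ i) = of_nat i * (B ^ j * (2 * (B - A)))"
      by (simp only: Suc pderiv_power_Suc smult mult_1_right X mult_ac)
    then show ?thesis using Suc by (simp add: algebra_simps)
  qed simp
  have HP: "half_poly N i = A ^ i * B ^ (N - i)" for i
    by (simp add: half_poly_def A_def B_def)
  obtain l where l: "N - K = Suc l" "N - Suc K = l" using K by (metis Suc_diff_Suc)
  have "X * pderiv (half_poly N K) = X * pderiv (A ^ K) * B ^ (N - K) + A ^ K * (X * pderiv (B ^ (N - K)))"
    by (simp add: HP pderiv_mult algebra_simps)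
  also have "\<dots> = of_nat K * (A ^ (K - 1) * B ^ (Suc (N - K)) - A ^ K * B ^ (N - K))
      + of_nat (N - K) * (2 * (A ^ K * B ^ (N - K) - A ^ Suc K * B ^ l))"
    unfolding XA XB by (simp add: l algebra_simps)
  also have "of_nat K * (A ^ (K - 1) * B ^ (Suc (N - K)) - A ^ K * B ^ (N - K))
      = of_nat K * (half_poly N (K - 1) - half_poly N K)"
    using K by (cases K) (auto simp: HP Suc_diff_Suc)
  also have "A ^ K * B ^ (N - K) - A ^ Suc K * B ^ l = half_poly N K - half_poly N (Suc K)"
    by (simp add: HP l)
  finally have "coeff (X * pderiv (half_poly N K)) m =
     coeff (of_nat K * (half_poly N (K - 1) - half_poly N K)
       + of_nat (N - K) * (2 * (half_poly N K - half_poly N (Suc K)))) m" by simp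
  moreover have "coeff (X * pderiv (half_poly N K)) m = real m * coeff (half_poly N K) m"
    by (cases m) (auto simp: X_def coeff_pderiv)
  ultimately have "real m * coeff (half_poly N K) m =
      real K * (coeff (half_poly N (K - 1)) m - coeff (half_poly N K) m)
      + 2 * real (N - K) * (coeff (half_poly N K) m - coeff (half_poly N (Suc K)) m)"
    by (simp add: of_nat_poly numeral_poly)
  then show ?thesis
    unfolding one_way_prob_def
    by (metis (no_types, lifting) add_divide_distrib diff_divide_distrib times_divide_eq_right)
qed

text \<open>
  The conditional probability that one further slot also avoids its forbidden orientation.
\<close>
definition avoid_ratio :: "nat \<Rightarrow> nat \<Rightarrow> nat \<Rightarrow> real" where
  "avoid_ratio N m K = one_way_prob N m (Suc K) / one_way_prob N m K"

lemma avoid_ratio_le: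
  assumes "K < N" "m \<le> N"
  shows "avoid_ratio N m K \<le> 1 - m / (2 * N)"
  using one_way_prob_Suc_le[OF assms] one_way_prob_pos[of K N m] assms
  by (simp add: avoid_ratio_def pos_divide_le_eq)

lemma avoid_ratio_pos:
  assumes "K < N" "m \<le> N"
  shows "avoid_ratio N m K > 0"
  using assms by (simp add: avoid_ratio_def one_way_prob_pos)

text \<open>
  The leading value of the ratio is \<open>1 - q/2\<close>, as for independent edges. The correction, caused by the
  fixed number of edges, is explicit up to the previous ratio; as \<open>K\<close> is of order \<open>n\<close> and \<open>N\<close> of order
  \<open>n^2\<close>, a crude estimate of the previous ratio determines the correction up to \<open>o(1/n)\<close>.
\<close>
lemma avoid_ratio_recurrence:
  assumes "K < N" "m \<le> N"
  shows "avoid_ratio N m K - (1 - m / (2 * N))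
    = K / (2 * real (N - K)) * (1 / avoid_ratio N m (K - 1) - 1 - m / N)"
proof -
  define c where "c = one_way_prob N m"
  have pos: "c K > 0" "c (K - 1) > 0" using assms by (auto simp: c_def one_way_prob_pos)
  have ratio: "real K * (c (K - 1) / c K) = real K * (1 / avoid_ratio N m (K - 1))"
    by (cases K) (auto simp: avoid_ratio_def c_def)
  have "real m * c K = real K * (c (K - 1) - c K) + 2 * real (N - K) * (c K - c (Suc K))"
    unfolding c_def by (rule one_way_prob_recurrence[OF assms(1)])
  then have "real m * c K = (real K * (c (K - 1) / c K - 1) + 2 * real (N - K) * (1 - c (Suc K) / c K)) * c K"
    using pos(1) by (simp add: algebra_simps)
  then have "real m = real K * (c (K - 1) / c K - 1) + 2 * real (N - K) * (1 - c (Suc K) / c K)"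
    using pos(1) by simp
  then have "real m = real K * (1 / avoid_ratio N m (K - 1)) - real K + 2 * real (N - K) * (1 - avoid_ratio N m K)"
    using ratio by (simp add: avoid_ratio_def c_def algebra_simps)
  moreover define y where "y = 1 / avoid_ratio N m (K - 1)"
  moreover define D where "D = real (N - K)"
  ultimately have m: "real m = real K * y - real K + 2 * D * (1 - avoid_ratio N m K)" by simp
  have D: "D > 0" "real N = D + real K" "real N > 0" using assms by (auto simp: D_def)
  have "avoid_ratio N m K = 1 + (real K * y - real K - real m) / (2 * D)"
    using D(1) unfolding m by (simp add: field_simps)
  also have "\<dots> - (1 - m / (2 * N)) = K / (2 * D) * (y - 1 - m / N)"
    using D(1,3) unfolding of_nat_mult D(2) by (simp add: divide_simps) (simp add: algebra_simps)
  finally show ?thesis by (simp add: y_def D_def)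
qed

text \<open>
  In the recurrence the previous ratio is at most 1, so its contribution has a sign.
\<close>
lemma avoid_ratio_ge:
  assumes "K < N" "m \<le> N"
  shows "avoid_ratio N m K \<ge> 1 - m / (2 * real (N - K))"
proof -
  have NK: "real (N - K) = real N - real K" "real N - real K > 0" using assms by auto
  have "real K * (1 / avoid_ratio N m (K - 1) - 1) \<ge> 0"
  proof (cases K)
    case (Suc k)
    have "avoid_ratio N m k \<le> 1" using avoid_ratio_le[of k N m] assms Suc
      by (smt (verit) Suc_lessD divide_nonneg_nonneg of_nat_0_le_iff)
    then show ?thesis using avoid_ratio_pos[of k N m] assms Suc by simp
  qed simp
  then have "real K * (1 / avoid_ratio N m (K - 1) - 1) / (2 * real (N - K)) \<ge> 0"
    by (rule divide_nonneg_nonneg) simp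
  then have "K / (2 * real (N - K)) * (1 / avoid_ratio N m (K - 1) - 1) \<ge> 0"
    by simp
  moreover have E1: "avoid_ratio N m K - (1 - m / (2 * N))
      = K / (2 * real (N - K)) * (1 / avoid_ratio N m (K - 1) - 1) - K / (2 * real (N - K)) * (m / N)"
    using avoid_ratio_recurrence[OF assms] by (simp only: right_diff_distrib of_nat_mult of_nat_numeral)
  ultimately have "avoid_ratio N m K - (1 - m / (2 * N)) \<ge> - (K / (2 * real (N - K)) * (m / N))"
    unfolding E1 by linarith
  moreover have "m / (2 * N) + K / (2 * real (N - K)) * (m / N) = m / (2 * real (N - K))"
    using NK assms by (simp add: field_simps)
  moreover have "1 - w \<le> f" if "- u \<le> f - (1 - v)" "v + u = w" for u v w f :: real
    using that by linarith
  ultimately show ?thesis by blast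
qed

lemma one_way_prob_add:
  assumes "K + j \<le> N" "m \<le> N"
  shows "one_way_prob N m (K + j) = one_way_prob N m K * (\<Prod>i<j. avoid_ratio N m (K + i))"
  using assms
proof (induction j)
  case (Suc j)
  have "one_way_prob N m (K + j) \<noteq> 0" using one_way_prob_pos[of "K + j" N m] Suc.prems by auto
  then have "one_way_prob N m (K + Suc j) = one_way_prob N m (K + j) * avoid_ratio N m (K + j)"
    by (simp add: avoid_ratio_def)
  moreover have "one_way_prob N m (K + j) = one_way_prob N m K * (\<Prod>i<j. avoid_ratio N m (K + i))"
    using Suc by simp
  ultimately show ?case by (simp only: prod.lessThan_Suc mult.assoc)
qed simp

section \<open>Forbidden arcs in the random digraph\<close>


lemma finite_all_edges: "finite (all_edges n)"
  unfolding all_edges_def by (rule finite_subset[of _ "Pow {1..n}"]) auto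

lemma card_all_edges: "card (all_edges n) = n choose 2"
  unfolding all_edges_def by (subst n_subsets) auto

lemma edge_orientations_eq:
  assumes "u \<noteq> v" shows "edge_orientations {u, v} = {(u, v), (v, u)}"
  using assms by (auto simp: edge_orientations_def doubleton_eq_iff)

lemma all_edges_cases:
  assumes "e \<in> all_edges n"
  obtains u v where "e = {u, v}" "u \<noteq> v" "u \<in> {1..n}" "v \<in> {1..n}"
    "edge_orientations e = {(u, v), (v, u)}"
  using assms edge_orientations_eq unfolding all_edges_def card_2_iff by auto

lemma edge_orientations_finite_card:
  assumes "e \<in> all_edges n"
  shows "finite (edge_orientations e)" "card (edge_orientations e) = 2"
  using assms by (auto elim!: all_edges_cases)

definition arcs :: "nat \<Rightarrow> (nat \<times> nat) set" where
  "arcs n = {(u, v). u \<in> {1..n} \<and> v \<in> {1..n} \<and> u \<noteq> v}"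

lemma arcs_eq_UN: "arcs n = (\<Union>e\<in>all_edges n. edge_orientations e)"
  by (force simp: arcs_def all_edges_def edge_orientations_def card_2_iff doubleton_eq_iff)

lemma edge_orientations_disjoint: "e \<noteq> e' \<Longrightarrow> edge_orientations e \<inter> edge_orientations e' = {}"
  by (auto simp: edge_orientations_def)

definition avoiding :: "(nat \<times> nat) set \<Rightarrow> (nat \<times> nat) set set" where
  "avoiding \<Phi> = {D. D \<inter> \<Phi> = {}}"

text \<open>
  The probability that a random orientation of \<open>e\<close> is not forbidden by \<open>\<Phi>\<close>.
\<close>
definition edge_weight :: "(nat \<times> nat) set \<Rightarrow> nat set \<Rightarrow> real" where
  "edge_weight \<Phi> e = 1 - card (\<Phi> \<inter> edge_orientations e) / 2"

lemma edge_weight_bounds: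
  assumes "e \<in> all_edges n"
  shows "0 \<le> edge_weight \<Phi> e" "edge_weight \<Phi> e \<le> 1"
proof -
  have "card (\<Phi> \<inter> edge_orientations e) \<le> 2"
    using card_mono[of "edge_orientations e" "\<Phi> \<inter> edge_orientations e"]
      edge_orientations_finite_card[OF assms] by auto
  then show "0 \<le> edge_weight \<Phi> e" "edge_weight \<Phi> e \<le> 1" by (auto simp: edge_weight_def)
qed

lemma sum_card_edge_orientations:
  assumes "\<Phi> \<subseteq> arcs n"
  shows "(\<Sum>e\<in>all_edges n. card (\<Phi> \<inter> edge_orientations e)) = card \<Phi>"
proof -
  have "\<Phi> = (\<Union>e\<in>all_edges n. \<Phi> \<inter> edge_orientations e)" using assms arcs_eq_UN by auto
  also have "card \<dots> = (\<Sum>e\<in>all_edges n. card (\<Phi> \<inter> edge_orientations e))"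
    using edge_orientations_disjoint
    by (intro card_UN_disjoint) (auto simp: finite_all_edges edge_orientations_finite_card)
  finally show ?thesis by simp
qed

lemma graphs_finite_nonempty:
  assumes "m \<le> n choose 2"
  shows "finite {E. E \<subseteq> all_edges n \<and> card E = m}" "{E. E \<subseteq> all_edges n \<and> card E = m} \<noteq> {}"
    "card {E. E \<subseteq> all_edges n \<and> card E = m} = (n choose 2) choose m"
proof -
  show 1: "card {E. E \<subseteq> all_edges n \<and> card E = m} = (n choose 2) choose m"
    by (simp add: n_subsets finite_all_edges card_all_edges)
  show "finite {E. E \<subseteq> all_edges n \<and> card E = m}"
    by (rule finite_subset[of _ "Pow (all_edges n)"]) (auto simp: finite_all_edges)
  show "{E. E \<subseteq> all_edges n \<and> card E = m} \<noteq> {}"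
    using 1 assms by (metis card.empty binomial_eq_0_iff not_less)
qed

lemma prob_bind_pmf:
  "measure_pmf.prob (M \<bind> N) A = measure_pmf.expectation M (\<lambda>x. measure_pmf.prob (N x) A)"
proof -
  have "ennreal (measure_pmf.prob (M \<bind> N) A) = (\<integral>\<^sup>+x. ennreal (measure_pmf.prob (N x) A) \<partial>M)"
    by (simp add: measure_pmf.emeasure_eq_measure[symmetric])
  also have "\<dots> = ennreal (measure_pmf.expectation M (\<lambda>x. measure_pmf.prob (N x) A))"
    by (intro nn_integral_eq_integral measure_pmf.integrable_const_bound[where B = 1]) auto
  finally show ?thesis by (simp add: integral_nonneg_AE)
qed

text \<open>
  Given the graph, the edges avoid the forbidden orientations independently.
\<close>
lemma prob_orient_avoiding:
  assumes E: "E \<subseteq> all_edges n"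
  shows "measure_pmf.prob (Pi_pmf E undefined (\<lambda>e. pmf_of_set (edge_orientations e)) \<bind> (\<lambda>f. return_pmf (f ` E)))
     (avoiding \<Phi>) = (\<Prod>e\<in>E. edge_weight \<Phi> e)"
proof -
  have fin: "finite E" using E finite_all_edges finite_subset by blast
  have "measure_pmf.prob (map_pmf (\<lambda>f. f ` E) (Pi_pmf E undefined (\<lambda>e. pmf_of_set (edge_orientations e)))) (avoiding \<Phi>)
      = measure_pmf.prob (Pi_pmf E undefined (\<lambda>e. pmf_of_set (edge_orientations e))) (Pi E (\<lambda>_. - \<Phi>))"
    unfolding measure_map_pmf by (rule arg_cong2[where f = measure]) (auto simp: avoiding_def)
  also have "\<dots> = (\<Prod>e\<in>E. measure_pmf.prob (pmf_of_set (edge_orientations e)) (- \<Phi>))"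
    by (rule measure_Pi_pmf_Pi[OF fin])
  also have "\<dots> = (\<Prod>e\<in>E. edge_weight \<Phi> e)"
  proof (rule prod.cong)
    fix e assume "e \<in> E"
    then have e: "finite (edge_orientations e)" "card (edge_orientations e) = 2"
      using E edge_orientations_finite_card by blast+
    then have "edge_orientations e \<noteq> {}" by auto
    then have "measure_pmf.prob (pmf_of_set (edge_orientations e)) (- \<Phi>)
        = card (edge_orientations e - \<Phi> \<inter> edge_orientations e) / 2"
      using e by (simp add: measure_pmf_of_set Diff_Int2 Diff_eq Int_commute Int_Un_distrib)
    also have "\<dots> = edge_weight \<Phi> e"
      using e card_mono[of "edge_orientations e" "\<Phi> \<inter> edge_orientations e"]
      by (simp add: edge_weight_def card_Diff_subset of_nat_diff field_simps)
    finally show "measure_pmf.prob (pmf_of_set (edge_orientations e)) (- \<Phi>) = edge_weight \<Phi> e" .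
  qed simp
  finally show ?thesis by (simp add: map_pmf_def)
qed

lemma prob_avoiding:
  assumes m: "m \<le> n choose 2"
  shows "measure_pmf.prob (directed_gnm n m) (avoiding \<Phi>)
    = coeff (weight_poly (all_edges n) (edge_weight \<Phi>)) m / ((n choose 2) choose m)"
proof -
  let ?G = "{E. E \<subseteq> all_edges n \<and> card E = m}"
  have "measure_pmf.prob (directed_gnm n m) (avoiding \<Phi>)
     = measure_pmf.expectation (pmf_of_set ?G) (\<lambda>E. measure_pmf.prob
         (Pi_pmf E undefined (\<lambda>e. pmf_of_set (edge_orientations e)) \<bind> (\<lambda>f. return_pmf (f ` E))) (avoiding \<Phi>))"
    unfolding directed_gnm_def gnm_def by (rule prob_bind_pmf)
  also have "\<dots> = (\<Sum>E\<in>?G. measure_pmf.prob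
         (Pi_pmf E undefined (\<lambda>e. pmf_of_set (edge_orientations e)) \<bind> (\<lambda>f. return_pmf (f ` E))) (avoiding \<Phi>)) / card ?G"
    using graphs_finite_nonempty[OF m] by (intro integral_pmf_of_set) auto
  also have "\<dots> = (\<Sum>E\<in>?G. \<Prod>e\<in>E. edge_weight \<Phi> e) / card ?G"
    by (intro arg_cong2[where f = "(/)"] sum.cong prob_orient_avoiding[of _ n] refl) auto
  finally show ?thesis
    by (simp only: sum_subsets_eq_coeff_weight_poly[OF finite_all_edges] graphs_finite_nonempty(3)[OF m])
qed

lemma prob_avoiding_le_prod:
  assumes m: "m \<le> n choose 2"
  shows "measure_pmf.prob (directed_gnm n m) (avoiding \<Phi>)
    \<le> (\<Prod>e\<in>all_edges n. 1 - m / (n choose 2) * (1 - edge_weight \<Phi> e))"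
  unfolding prob_avoiding[OF m]
  using coeff_weight_poly_le_prod[OF finite_all_edges, of n "edge_weight \<Phi>" m] edge_weight_bounds m
  by (simp add: card_all_edges pos_divide_le_eq mult.commute)

text \<open>
  Every forbidden arc costs a factor \<open>1 - q/2\<close>. This holds even if both orientations of a slot
  are forbidden, because \<open>1 - q \<le> (1 - q/2)^2\<close>. All error terms except isolation are bounded in this way.
\<close>
lemma prob_avoiding_le_power:
  assumes m: "m \<le> n choose 2" and \<Phi>: "\<Phi> \<subseteq> arcs n"
  shows "measure_pmf.prob (directed_gnm n m) (avoiding \<Phi>) \<le> (1 - m / (2 * (n choose 2))) ^ card \<Phi>"
proof -
  define q where "q = real m / (n choose 2)"
  have q: "0 \<le> q" "q \<le> 1" using m by (auto simp: q_def divide_simps)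
  have "(\<Prod>e\<in>all_edges n. 1 - q * (1 - edge_weight \<Phi> e))
     \<le> (\<Prod>e\<in>all_edges n. (1 - q / 2) ^ card (\<Phi> \<inter> edge_orientations e))"
  proof (rule prod_mono, safe)
    fix e assume e: "e \<in> all_edges n"
    let ?c = "card (\<Phi> \<inter> edge_orientations e)"
    show "0 \<le> 1 - q * (1 - edge_weight \<Phi> e)"
      using q edge_weight_bounds[OF e, of \<Phi>] by (simp add: mult_le_one)
    have "?c \<le> 2"
      using card_mono[of "edge_orientations e" "\<Phi> \<inter> edge_orientations e"]
        edge_orientations_finite_card[OF e] by auto
    then consider "?c = 0" | "?c = 1" | "?c = 2" by linarith
    then show "1 - q * (1 - edge_weight \<Phi> e) \<le> (1 - q / 2) ^ ?c"
      by cases (auto simp: edge_weight_def power2_eq_square algebra_simps)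
  qed
  also have "\<dots> = (1 - q / 2) ^ card \<Phi>"
    by (simp add: power_sum[symmetric] sum_card_edge_orientations[OF \<Phi>])
  finally show ?thesis
    using prob_avoiding_le_prod[OF m, of \<Phi>] by (simp add: q_def mult.commute)
qed

lemma prob_avoiding_one_way:
  assumes m: "m \<le> n choose 2" and \<Phi>: "\<Phi> \<subseteq> arcs n" "\<Phi> \<inter> \<Phi>\<inverse> = {}"
  shows "measure_pmf.prob (directed_gnm n m) (avoiding \<Phi>) = one_way_prob (n choose 2) m (card \<Phi>)"
proof -
  define T where "T = {e \<in> all_edges n. card (\<Phi> \<inter> edge_orientations e) = 1}"
  have c: "card (\<Phi> \<inter> edge_orientations e) = (if e \<in> T then 1 else 0)" if "e \<in> all_edges n" for e
  proof -
    from that obtain u v where e: "edge_orientations e = {(u, v), (v, u)}" "u \<noteq> v"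
      by (elim all_edges_cases)
    have "\<Phi> \<inter> edge_orientations e = {} \<or> \<Phi> \<inter> edge_orientations e = {(u, v)} \<or> \<Phi> \<inter> edge_orientations e = {(v, u)}"
      using \<Phi>(2) e by auto
    then show ?thesis using that by (auto simp: T_def)
  qed
  have "card \<Phi> = (\<Sum>e\<in>all_edges n. if e \<in> T then 1 else 0)"
    by (subst sum_card_edge_orientations[OF \<Phi>(1), symmetric]) (simp add: c)
  also have "\<dots> = card T"
    by (subst sum.inter_filter[symmetric]) (auto simp: finite_all_edges T_def intro!: arg_cong[where f = card])
  finally have "card \<Phi> = card T" .
  moreover have "weight_poly (all_edges n) (edge_weight \<Phi>) = half_poly (n choose 2) (card T)"
    by (subst weight_poly_halves[of _ T])
       (auto simp: finite_all_edges card_all_edges edge_weight_def c, auto simp: T_def)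
  ultimately show ?thesis
    unfolding prob_avoiding[OF m] one_way_prob_def by simp
qed

text \<open>
  Isolating \<open>s\<close> forbids \<open>2 * (n - 1)\<close> arcs, about as many as the dominant configurations do, so
  counting arcs is not enough. What helps is that a doubly forbidden slot costs \<open>1 - q\<close>, which is
  strictly less than \<open>(1 - q/2)^2\<close>.
\<close>
lemma prob_isolated_le:
  assumes m: "m \<le> n choose 2" and s: "s \<in> {1..n}"
  shows "measure_pmf.prob (directed_gnm n m) (avoiding {(u, v) \<in> arcs n. u = s \<or> v = s})
    \<le> (1 - m / (n choose 2)) ^ (n - 1)"
proof -
  define q where "q = real m / (n choose 2)"
  have q: "0 \<le> q" "q \<le> 1" using m by (auto simp: q_def divide_simps)
  let ?\<Phi> = "{(u, v) \<in> arcs n. u = s \<or> v = s}"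
  let ?T = "(\<lambda>v. {s, v}) ` ({1..n} - {s})"
  have T: "?T \<subseteq> all_edges n" using s by (auto simp: all_edges_def)
  have w: "edge_weight ?\<Phi> e = (if e \<in> ?T then 0 else 1)" if e: "e \<in> all_edges n" for e
  proof -
    from e obtain u v where uv: "e = {u, v}" "u \<noteq> v" "u \<in> {1..n}" "v \<in> {1..n}"
      and o: "edge_orientations e = {(u, v), (v, u)}" by (elim all_edges_cases)
    show ?thesis
    proof (cases "u = s \<or> v = s")
      case True
      then have "?\<Phi> \<inter> edge_orientations e = {(u, v), (v, u)}" "e \<in> ?T"
        using uv o by (auto simp: arcs_def insert_commute)
      then show ?thesis using uv by (simp add: edge_weight_def)
    next
      case False
      then have "?\<Phi> \<inter> edge_orientations e = {}" "e \<notin> ?T"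
        using uv o by (auto simp: doubleton_eq_iff)
      then show ?thesis by (simp add: edge_weight_def)
    qed
  qed
  have "card ?T = n - 1"
    using s by (subst card_image) (auto simp: inj_on_def doubleton_eq_iff)
  have "(\<Prod>e\<in>all_edges n. 1 - q * (1 - edge_weight ?\<Phi> e)) = (\<Prod>e\<in>all_edges n. if e \<in> ?T then 1 - q else 1)"
    by (rule prod.cong) (auto simp: w)
  also have "\<dots> = (\<Prod>e\<in>?T. 1 - q)"
    using T by (intro prod.mono_neutral_cong_right) (auto simp: finite_all_edges)
  also have "\<dots> = (1 - q) ^ (n - 1)" using \<open>card ?T = n - 1\<close> by simp
  finally show ?thesis
    using prob_avoiding_le_prod[OF m, of ?\<Phi>] by (simp add: q_def)
qed

lemma directed_gnm_subset_arcs: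
  assumes m: "m \<le> n choose 2" and D: "D \<in> set_pmf (directed_gnm n m)"
  shows "D \<subseteq> arcs n"
proof -
  from D obtain E f where E: "E \<subseteq> all_edges n" and D: "D = f ` E"
    and f: "f \<in> set_pmf (Pi_pmf E undefined (\<lambda>e. pmf_of_set (edge_orientations e)))"
    using graphs_finite_nonempty[OF m] by (auto simp: directed_gnm_def gnm_def)
  have fin: "finite E" using E finite_all_edges finite_subset by blast
  have "f e \<in> edge_orientations e" if "e \<in> E" for e
  proof -
    have "f \<in> PiE_dflt E undefined (\<lambda>e. set_pmf (pmf_of_set (edge_orientations e)))"
      using f set_Pi_pmf_subset'[OF fin, of undefined] by (auto simp: comp_def)
    then have "f e \<in> set_pmf (pmf_of_set (edge_orientations e))"
      using that by (auto simp: PiE_dflt_def)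
    moreover have "finite (edge_orientations e)" "card (edge_orientations e) = 2"
      using that E edge_orientations_finite_card by blast+
    then have "finite (edge_orientations e)" "edge_orientations e \<noteq> {}" by auto
    ultimately show ?thesis by simp
  qed
  then show ?thesis unfolding D arcs_eq_UN using E by auto
qed

section \<open>Out-closed sets and the dominant configurations\<close>


definition out_cut :: "nat \<Rightarrow> nat set \<Rightarrow> (nat \<times> nat) set" where
  "out_cut n X = X \<times> ({1..n} - X)"

lemma avoiding_Un: "avoiding (\<Phi> \<union> \<Psi>) = avoiding \<Phi> \<inter> avoiding \<Psi>"
  by (auto simp: avoiding_def)

lemma avoiding_antimono: "\<Phi> \<subseteq> \<Psi> \<Longrightarrow> avoiding \<Psi> \<subseteq> avoiding \<Phi>"
  by (auto simp: avoiding_def)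

text \<open>
  The arcs from \<open>X\<close> to \<open>W\<close> and those from \<open>W\<close> to \<open>Y\<close> are distinct even if \<open>X\<close> and \<open>Y\<close> overlap.
\<close>
lemma prob_avoiding_biclique_le:
  assumes m: "m \<le> n choose 2" and sub: "X \<subseteq> {1..n}" "Y \<subseteq> {1..n}" "W \<subseteq> {1..n}"
    and disj: "X \<inter> W = {}" "Y \<inter> W = {}" and \<Phi>: "X \<times> W \<union> W \<times> Y \<subseteq> \<Phi>"
  shows "measure_pmf.prob (directed_gnm n m) (avoiding \<Phi>)
    \<le> (1 - m / (2 * (n choose 2))) ^ ((card X + card Y) * card W)"
proof -
  have fin: "finite X" "finite Y" "finite W" using sub finite_subset by blast+
  have "card (X \<times> W \<union> W \<times> Y) = (card X + card Y) * card W"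
    using fin disj by (subst card_Un_disjoint) (auto simp: card_cartesian_product algebra_simps)
  moreover have "X \<times> W \<union> W \<times> Y \<subseteq> arcs n" using sub disj by (auto simp: arcs_def)
  moreover have "measure_pmf.prob (directed_gnm n m) (avoiding \<Phi>)
      \<le> measure_pmf.prob (directed_gnm n m) (avoiding (X \<times> W \<union> W \<times> Y))"
    by (intro measure_pmf.finite_measure_mono avoiding_antimono \<Phi>) auto
  ultimately show ?thesis using prob_avoiding_le_power[OF m, of "X \<times> W \<union> W \<times> Y"] by simp
qed

text \<open>
  Outside this event every out-closed set has at most \<open>j\<close> elements or misses at most \<open>j\<close> vertices.
\<close>
definition mid_closed :: "nat \<Rightarrow> nat \<Rightarrow> (nat \<times> nat) set set" where
  "mid_closed n j = (\<Union>X\<in>{X. X \<subseteq> {1..n} \<and> j < card X \<and> card X < n - j}. avoiding (out_cut n X))"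

lemma prob_mid_closed_le:
  assumes m: "m \<le> n choose 2"
  shows "measure_pmf.prob (directed_gnm n m) (mid_closed n j)
    \<le> (\<Sum>k\<in>{j<..<n - j}. (n choose k) * (1 - m / (2 * (n choose 2))) ^ (k * (n - k)))"
proof -
  let ?P = "measure_pmf.prob (directed_gnm n m)" and ?r = "1 - m / (2 * (n choose 2))"
  let ?I = "{X. X \<subseteq> {1..n} \<and> j < card X \<and> card X < n - j}"
  have fin: "finite ?I" by (rule finite_subset[of _ "Pow {1..n}"]) auto
  have "?P (mid_closed n j) \<le> (\<Sum>X\<in>?I. ?P (avoiding (out_cut n X)))"
    unfolding mid_closed_def by (rule measure_pmf.finite_measure_subadditive_finite[OF fin]) auto
  also have "\<dots> \<le> (\<Sum>X\<in>?I. ?r ^ (card X * (n - card X)))"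
  proof (rule sum_mono)
    fix X assume "X \<in> ?I"
    then have X: "X \<subseteq> {1..n}" "finite X" using finite_subset by blast+
    have "?P (avoiding (out_cut n X)) \<le> ?r ^ ((card X + card ({} :: nat set)) * card ({1..n} - X))"
      using X by (intro prob_avoiding_biclique_le[OF m]) (auto simp: out_cut_def)
    then show "?P (avoiding (out_cut n X)) \<le> ?r ^ (card X * (n - card X))"
      using X by (simp add: card_Diff_subset)
  qed
  also have "\<dots> = (\<Sum>k\<in>{j<..<n - j}. \<Sum>X\<in>{X \<in> ?I. card X = k}. ?r ^ (card X * (n - card X)))"
    by (rule sum.group[symmetric]) (use fin in auto)
  also have "\<dots> = (\<Sum>k\<in>{j<..<n - j}. (n choose k) * ?r ^ (k * (n - k)))"
  proof (rule sum.cong)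
    fix k assume "k \<in> {j<..<n - j}"
    then have eq: "{X \<in> ?I. card X = k} = {X. X \<subseteq> {1..n} \<and> card X = k}" by auto
    have "(\<Sum>X\<in>{X \<in> ?I. card X = k}. ?r ^ (card X * (n - card X)))
        = (\<Sum>X\<in>{X \<in> ?I. card X = k}. ?r ^ (k * (n - k)))" by (rule sum.cong) auto
    also have "\<dots> = (n choose k) * ?r ^ (k * (n - k))"
      unfolding eq by (simp add: n_subsets)
    finally show "(\<Sum>X\<in>{X \<in> ?I. card X = k}. ?r ^ (card X * (n - card X)))
        = (n choose k) * ?r ^ (k * (n - k))" .
  qed simp
  finally show ?thesis .
qed

definition small_sets :: "nat \<Rightarrow> nat set set" where
  "small_sets n = (\<lambda>(x, y). {x, y}) ` ({1..n} \<times> {1..n})"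

lemma card_small_sets_le: "card (small_sets n) \<le> n ^ 2"
  unfolding small_sets_def
  by (rule order.trans[OF card_image_le]) (auto simp: power2_eq_square)

lemma in_small_sets:
  assumes "X \<subseteq> {1..n}" "X \<noteq> {}" "card X \<le> 2"
  shows "X \<in> small_sets n"
proof -
  have "finite X" using assms finite_subset by blast
  then have "card X \<noteq> 0" using assms by simp
  then consider "card X = 1" | "card X = 2" using assms by linarith
  then show ?thesis
  proof cases
    case 1
    then obtain x where "X = {x}" by (auto simp: card_1_singleton_iff)
    then show ?thesis using assms unfolding small_sets_def
      by (intro image_eqI[of _ _ "(x, x)"]) auto
  next
    case 2
    then obtain x y where "X = {x, y}" by (auto simp: card_2_iff)
    then show ?thesis using assms unfolding small_sets_def
      by (intro image_eqI[of _ _ "(x, y)"]) auto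
  qed
qed

text \<open>
  Pairs of singletons are left out because they lead to the dominant configurations or to isolation of a
  vertex. Any other pair forbids about \<open>3 * n\<close> arcs, against \<open>2 * n\<close> for the dominant configurations.
\<close>
definition small_pair :: "nat \<Rightarrow> (nat \<times> nat) set set" where
  "small_pair n = (\<Union>(X, Y)\<in>{(X, Y) \<in> small_sets n \<times> small_sets n. 3 \<le> card X + card Y}.
      avoiding (X \<times> ({1..n} - X - Y) \<union> ({1..n} - X - Y) \<times> Y))"

lemma prob_small_pair_le:
  assumes m: "m \<le> n choose 2"
  shows "measure_pmf.prob (directed_gnm n m) (small_pair n)
    \<le> real n ^ 4 * (1 - m / (2 * (n choose 2))) ^ (3 * (n - 4))"
proof -
  let ?P = "measure_pmf.prob (directed_gnm n m)"
  define r where "r = 1 - real m / (2 * (n choose 2))"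
  have r: "0 \<le> r" "r \<le> 1" using m by (auto simp: r_def divide_simps)
  let ?I = "{(X, Y) \<in> small_sets n \<times> small_sets n. 3 \<le> card X + card Y}"
  let ?A = "\<lambda>(X, Y). avoiding (X \<times> ({1..n} - X - Y) \<union> ({1..n} - X - Y) \<times> Y)"
  have fin0: "finite (small_sets n)" by (simp add: small_sets_def)
  then have fin: "finite ?I" by (rule_tac finite_subset[of _ "small_sets n \<times> small_sets n"]) auto
  have "?P (small_pair n) \<le> (\<Sum>p\<in>?I. ?P (?A p))"
    unfolding small_pair_def by (rule measure_pmf.finite_measure_subadditive_finite[OF fin]) auto
  also have "\<dots> \<le> (\<Sum>p\<in>?I. r ^ (3 * (n - 4)))"
  proof (rule sum_mono, clarify)
    fix X Y assume X: "X \<in> small_sets n" and Y: "Y \<in> small_sets n" and c: "3 \<le> card X + card Y"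
    have sub: "X \<subseteq> {1..n}" "Y \<subseteq> {1..n}" "finite X" "finite Y" "card X \<le> 2" "card Y \<le> 2"
      using X Y by (auto simp: small_sets_def card_insert_if)
    have "{1..n} - X - Y = {1..n} - (X \<union> Y)" by blast
    then have "card ({1..n} - X - Y) = n - card (X \<union> Y)"
      using sub by (simp add: card_Diff_subset)
    moreover have "card (X \<union> Y) \<le> 4" using card_Un_le[of X Y] sub by linarith
    ultimately have W: "card ({1..n} - X - Y) \<ge> n - 4" by linarith
    have "?P (avoiding (X \<times> ({1..n} - X - Y) \<union> ({1..n} - X - Y) \<times> Y))
        \<le> r ^ ((card X + card Y) * card ({1..n} - X - Y))"
      unfolding r_def using sub by (intro prob_avoiding_biclique_le[OF m]) auto
    also have "\<dots> \<le> r ^ (3 * (n - 4))"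
      using r c W by (intro power_decreasing mult_le_mono) auto
    finally show "?P (avoiding (X \<times> ({1..n} - X - Y) \<union> ({1..n} - X - Y) \<times> Y)) \<le> r ^ (3 * (n - 4))" .
  qed
  also have "\<dots> = card ?I * r ^ (3 * (n - 4))" by simp
  also have "\<dots> \<le> real n ^ 4 * r ^ (3 * (n - 4))"
  proof (rule mult_right_mono)
    have "card ?I \<le> card (small_sets n \<times> small_sets n)" using fin0 by (intro card_mono) auto
    also have "\<dots> \<le> n ^ 2 * n ^ 2"
      unfolding card_cartesian_product by (intro mult_le_mono card_small_sets_le)
    finally have "card ?I \<le> n ^ 4" by (simp flip: power_add)
    then show "real (card ?I) \<le> real n ^ 4"
      unfolding of_nat_power[symmetric] of_nat_le_iff .
  qed (use r in auto)
  finally show ?thesis by (simp add: r_def)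
qed

definition reach :: "nat \<Rightarrow> (nat \<times> nat) set \<Rightarrow> nat \<Rightarrow> nat set" where
  "reach n D s = {v \<in> {1..n}. (s, v) \<in> D\<^sup>*}"

definition out_closed :: "nat \<Rightarrow> (nat \<times> nat) set \<Rightarrow> nat set \<Rightarrow> bool" where
  "out_closed n D X \<longleftrightarrow> X \<subseteq> {1..n} \<and> D \<inter> out_cut n X = {}"

lemma out_closed_iff:
  "out_closed n D X \<longleftrightarrow> X \<subseteq> {1..n} \<and> (\<forall>u\<in>X. \<forall>v\<in>{1..n}. (u, v) \<in> D \<longrightarrow> v \<in> X)"
  by (auto simp: out_closed_def out_cut_def)

lemma out_closed_reach: "out_closed n D (reach n D s)"
  by (auto simp: out_closed_iff reach_def intro: rtrancl_into_rtrancl)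

lemma out_closed_Un: "out_closed n D X \<Longrightarrow> out_closed n D Y \<Longrightarrow> out_closed n D (X \<union> Y)"
  and out_closed_Int: "out_closed n D X \<Longrightarrow> out_closed n D Y \<Longrightarrow> out_closed n D (X \<inter> Y)"
  by (auto simp: out_closed_iff)

lemma out_closed_card:
  assumes "out_closed n D X" "D \<notin> mid_closed n j"
  shows "card X \<le> j \<or> card ({1..n} - X) \<le> j"
proof -
  have X: "X \<subseteq> {1..n}" "finite X" using assms finite_subset by (auto simp: out_closed_def)
  then have "card ({1..n} - X) = n - card X" by (simp add: card_Diff_subset)
  moreover have "\<not> (j < card X \<and> card X < n - j)"
    using assms X by (auto simp: mid_closed_def avoiding_def out_closed_def)
  ultimately show ?thesis by linarith
qed

lemma no_path_if_out_closed:
  assumes "D \<subseteq> arcs n" "out_closed n D X" "s \<in> X" "a \<notin> X"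
  shows "D \<in> no_path_event s a"
proof -
  have "v \<in> X" if "(s, v) \<in> D\<^sup>*" for v
    using that
  proof (induction rule: rtrancl_induct)
    case (step y z)
    then have "z \<in> {1..n}" using assms(1) by (auto simp: arcs_def)
    then show ?case using step assms(2) by (auto simp: out_closed_iff)
  qed (rule assms(3))
  then show ?thesis using assms(4) by (auto simp: no_path_event_def path_event_def)
qed

definition sink_arcs :: "nat \<Rightarrow> nat \<Rightarrow> (nat \<times> nat) set" where
  "sink_arcs n s = {s} \<times> ({1..n} - {s})"

definition source_arcs :: "nat \<Rightarrow> nat \<Rightarrow> (nat \<times> nat) set" where
  "source_arcs n a = ({1..n} - {a}) \<times> {a}"

lemma card_1_eq: "card X \<le> 1 \<Longrightarrow> finite X \<Longrightarrow> x \<in> X \<Longrightarrow> X = {x}"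
  by (metis card_le_Suc0_iff_eq One_nat_def insertI1 is_singletonI' is_singleton_the_elem singletonD empty_iff)

text \<open>
  The set reachable from \<open>s\<close> is out-closed, contains \<open>s\<close> and misses \<open>a\<close>. Outside \<open>mid_closed n 1\<close> it is
  therefore \<open>{s}\<close>, or its complement is \<open>{a}\<close>.
\<close>
lemma no_path_event_subset:
  assumes V: "s \<in> {1..n}" "a \<in> {1..n}"
  shows "no_path_event s a \<subseteq> avoiding (sink_arcs n s) \<union> avoiding (source_arcs n a) \<union> mid_closed n 1"
proof
  fix D assume D: "D \<in> no_path_event s a"
  let ?S = "reach n D s"
  have S: "s \<in> ?S" "a \<notin> ?S" using D V by (auto simp: reach_def no_path_event_def path_event_def)
  have cl: "out_closed n D ?S" by (rule out_closed_reach)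
  then have sub: "?S \<subseteq> {1..n}" "finite ?S" using finite_subset by (auto simp: out_closed_def)
  show "D \<in> avoiding (sink_arcs n s) \<union> avoiding (source_arcs n a) \<union> mid_closed n 1"
  proof (cases "D \<in> mid_closed n 1")
    case False
    with out_closed_card[OF cl] consider "card ?S \<le> 1" | "card ({1..n} - ?S) \<le> 1" by blast
    then show ?thesis
    proof cases
      case 1
      then have "?S = {s}" using S sub by (intro card_1_eq) auto
      then show ?thesis using cl by (auto simp: out_closed_def out_cut_def sink_arcs_def avoiding_def)
    next
      case 2
      then have "{1..n} - ?S = {a}" using S sub V by (intro card_1_eq) auto
      then have "?S = {1..n} - {a}" using sub by blast
      with cl have "out_closed n D ({1..n} - {a})" by simp
      then have "D \<in> avoiding (source_arcs n a)" using V
        unfolding out_closed_iff source_arcs_def avoiding_def by blast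
      then show ?thesis by blast
    qed
  qed simp
qed

text \<open>
  The arcs to be avoided for \<open>b\<close> to be a sink and \<open>{s, b}\<close> out-closed: an arc from \<open>s\<close> to \<open>b\<close>
  remains possible.
\<close>
definition sinks_arcs :: "nat \<Rightarrow> nat \<Rightarrow> nat \<Rightarrow> (nat \<times> nat) set" where
  "sinks_arcs n s b = sink_arcs n b \<union> {s} \<times> ({1..n} - {s, b})"

text \<open>
  The mirror image: \<open>a\<close> is a source, and only \<open>a\<close> may have an arc to \<open>s\<close>.
\<close>
definition sources_arcs :: "nat \<Rightarrow> nat \<Rightarrow> nat \<Rightarrow> (nat \<times> nat) set" where
  "sources_arcs n s a = source_arcs n a \<union> ({1..n} - {s, a}) \<times> {s}"

text \<open>
  Here \<open>b\<close> is a sink and \<open>a\<close> is a source. The arc from \<open>b\<close> to \<open>a\<close>, which both conditions forbid, is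
  listed once.
\<close>
definition ends_arcs :: "nat \<Rightarrow> nat \<Rightarrow> nat \<Rightarrow> (nat \<times> nat) set" where
  "ends_arcs n a b = sink_arcs n b \<union> ({1..n} - {a, b}) \<times> {a}"

definition isolating_arcs :: "nat \<Rightarrow> nat \<Rightarrow> (nat \<times> nat) set" where
  "isolating_arcs n s = {(u, v) \<in> arcs n. u = s \<or> v = s}"

lemma card_2_eq: "card X \<le> 2 \<Longrightarrow> finite X \<Longrightarrow> x \<in> X \<Longrightarrow> y \<in> X \<Longrightarrow> x \<noteq> y \<Longrightarrow> X = {x, y}"
  using card_seteq[of X "{x, y}"] by auto

text \<open>
  Let \<open>S\<close> and \<open>T\<close> be the sets reachable from \<open>s\<close> and \<open>b\<close>. Outside \<open>mid_closed n 2\<close> each out-closed set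
  or its complement has at most two elements. If \<open>S\<close> and \<open>T\<close> are both small, then so is the out-closed
  set \<open>S \<union> T\<close>, which must be \<open>{s, b}\<close>, and \<open>T = {b}\<close>. If both complements are small, the complement of
  \<open>S \<inter> T\<close> must be \<open>{a, s}\<close>. In the mixed cases either more than two vertices are involved, which is a
  \<open>small_pair\<close>, or \<open>T\<close> and the complement of \<open>S\<close> are \<open>{b}\<close> and \<open>{a}\<close>, or else \<open>S\<close> and the complement of
  \<open>T\<close> are both \<open>{s}\<close>, so that \<open>s\<close> is isolated.
\<close>
lemma no_path_events_subset:
  assumes n: "n \<ge> 7" and V: "s \<in> {1..n}" "a \<in> {1..n}" "b \<in> {1..n}" and dist: "distinct [s, a, b]"
  shows "no_path_event s a \<inter> no_path_event b s \<subseteq>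
    avoiding (sinks_arcs n s b) \<union> avoiding (sources_arcs n s a) \<union> avoiding (ends_arcs n a b)
    \<union> mid_closed n 2 \<union> small_pair n \<union> avoiding (isolating_arcs n s)" (is "_ \<subseteq> ?R")
proof
  fix D assume D: "D \<in> no_path_event s a \<inter> no_path_event b s"
  let ?V = "{1..n}"
  define S where "S = reach n D s"
  define T where "T = reach n D b"
  have S: "s \<in> S" "a \<notin> S" and T: "b \<in> T" "s \<notin> T"
    using D V by (auto simp: S_def T_def reach_def no_path_event_def path_event_def)
  have cl: "out_closed n D S" "out_closed n D T" unfolding S_def T_def by (rule out_closed_reach)+
  then have sub: "S \<subseteq> ?V" "T \<subseteq> ?V" and fin: "finite S" "finite T"
    using finite_subset by (auto simp: out_closed_def)
  have mixed: "D \<in> small_pair n \<or> (card X \<le> 1 \<and> card (?V - Z) \<le> 1)"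
    if "out_closed n D X" "out_closed n D Z" "X \<noteq> {}" "?V - Z \<noteq> {}" "card X \<le> 2" "card (?V - Z) \<le> 2" for X Z
  proof (cases "3 \<le> card X + card (?V - Z)")
    case True
    have "X \<in> small_sets n" "?V - Z \<in> small_sets n"
      using that by (auto intro!: in_small_sets simp: out_closed_def)
    moreover have "D \<in> avoiding (X \<times> (?V - X - (?V - Z)) \<union> (?V - X - (?V - Z)) \<times> (?V - Z))"
      using that(1,2) by (auto simp: avoiding_def out_closed_iff)
    ultimately show ?thesis using True by (auto simp: small_pair_def)
  next
    case False
    have "finite X" "finite (?V - Z)" using that(1) finite_subset[of X ?V] by (auto simp: out_closed_def)
    then have "card X \<noteq> 0" "card (?V - Z) \<noteq> 0" using that(3,4) by auto
    then show ?thesis using False by linarith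
  qed
  show "D \<in> ?R"
  proof (cases "D \<in> mid_closed n 2")
    case False
    note extreme = out_closed_card[OF _ False]
    have cardV: "card (?V - X) = n - card X" if "X \<subseteq> ?V" for X
      using finite_subset[OF that] that by (simp add: card_Diff_subset)
    consider "card S \<le> 2" "card T \<le> 2" | "card (?V - S) \<le> 2" "card (?V - T) \<le> 2"
      | "card (?V - S) \<le> 2" "card T \<le> 2" | "card S \<le> 2" "card (?V - T) \<le> 2"
      using extreme[OF cl(1)] extreme[OF cl(2)] by blast
    then show ?thesis
    proof cases
      case 1
      have "card (S \<union> T) \<le> 4" using 1 card_Un_le[of S T] by linarith
      then have "card (S \<union> T) \<le> 2"
        using extreme[OF out_closed_Un[OF cl]] cardV[of "S \<union> T"] sub n by auto
      then have ST: "S \<union> T = {s, b}" using S T dist fin by (intro card_2_eq) auto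
      then have "T = {b}" using T by auto
      with ST cl out_closed_Un[OF cl] have "out_closed n D {s, b}" "out_closed n D {b}" by auto
      then have "D \<in> avoiding (sinks_arcs n s b)"
        unfolding avoiding_def sinks_arcs_def sink_arcs_def out_closed_iff by blast
      then show ?thesis by blast
    next
      case 2
      have compl: "?V - (S \<inter> T) = (?V - S) \<union> (?V - T)" by blast
      have "card (?V - (S \<inter> T)) \<le> 4"
        unfolding compl using 2 card_Un_le[of "?V - S" "?V - T"] by linarith
      moreover have "card (?V - (S \<inter> T)) = n - card (S \<inter> T)"
        by (rule cardV) (use sub in blast)
      ultimately have "\<not> card (S \<inter> T) \<le> 2" using n by linarith
      moreover have "card (S \<inter> T) \<le> 2 \<or> card (?V - (S \<inter> T)) \<le> 2"
        by (rule extreme[OF out_closed_Int[OF cl]])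
      ultimately have "card (?V - (S \<inter> T)) \<le> 2" by simp
      then have eq: "?V - (S \<inter> T) = {a, s}" using S T dist fin V by (intro card_2_eq) auto
      then have "?V - S = {a}" using S V by auto
      then have Seq: "S = ?V - {a}" and STeq: "S \<inter> T = ?V - {a, s}" using sub eq by blast+
      have "out_closed n D (?V - {a})" using cl(1) unfolding Seq .
      moreover have "out_closed n D (?V - {a, s})" using out_closed_Int[OF cl] unfolding STeq .
      ultimately have "D \<in> avoiding (sources_arcs n s a)" using V
        unfolding avoiding_def sources_arcs_def source_arcs_def out_closed_iff by blast
      then show ?thesis by blast
    next
      case 3
      have "D \<in> small_pair n \<or> (card T \<le> 1 \<and> card (?V - S) \<le> 1)"
        using S T V 3 by (intro mixed cl) auto
      then show ?thesis
      proof
        assume c: "card T \<le> 1 \<and> card (?V - S) \<le> 1"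
        have "T = {b}" using c T fin by (intro card_1_eq) auto
        moreover have "?V - S = {a}" using c S V by (intro card_1_eq) auto
        then have "S = ?V - {a}" using sub by blast
        ultimately have "out_closed n D {b}" "out_closed n D (?V - {a})" using cl by auto
        then have "D \<in> avoiding (ends_arcs n a b)" using V
          unfolding avoiding_def ends_arcs_def sink_arcs_def out_closed_iff by blast
        then show ?thesis by blast
      qed blast
    next
      case 4
      have "D \<in> small_pair n \<or> (card S \<le> 1 \<and> card (?V - T) \<le> 1)"
        using S T V 4 by (intro mixed cl) auto
      then show ?thesis
      proof
        assume c: "card S \<le> 1 \<and> card (?V - T) \<le> 1"
        have "S = {s}" using c S fin by (intro card_1_eq) auto
        moreover have "?V - T = {s}" using c T V by (intro card_1_eq) auto
        then have "T = ?V - {s}" using sub by blast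
        ultimately have "out_closed n D {s}" "out_closed n D (?V - {s})" using cl by auto
        then have "D \<in> avoiding (isolating_arcs n s)" using V
          unfolding avoiding_def isolating_arcs_def arcs_def out_closed_iff by blast
        then show ?thesis by blast
      qed blast
    qed
  qed blast
qed

section \<open>Bounds for the probabilities of unreachability\<close>


lemma card_sink_arcs: "s \<in> {1..n} \<Longrightarrow> card (sink_arcs n s) = n - 1"
  by (simp add: sink_arcs_def card_cartesian_product)

lemma card_source_arcs: "a \<in> {1..n} \<Longrightarrow> card (source_arcs n a) = n - 1"
  by (simp add: source_arcs_def card_cartesian_product)

lemma prob_sink:
  assumes m: "m \<le> n choose 2" and s: "s \<in> {1..n}"
  shows "measure_pmf.prob (directed_gnm n m) (avoiding (sink_arcs n s)) = one_way_prob (n choose 2) m (n - 1)"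
  by (subst prob_avoiding_one_way[OF m])
     (use s in \<open>auto simp: card_sink_arcs\<close>, auto simp: sink_arcs_def arcs_def)

lemma prob_source:
  assumes m: "m \<le> n choose 2" and a: "a \<in> {1..n}"
  shows "measure_pmf.prob (directed_gnm n m) (avoiding (source_arcs n a)) = one_way_prob (n choose 2) m (n - 1)"
  by (subst prob_avoiding_one_way[OF m])
     (use a in \<open>auto simp: card_source_arcs\<close>, auto simp: source_arcs_def arcs_def)

text \<open>
  All three dominant configurations forbid the same number of arcs, hence have the same probability.
\<close>
lemma card_pair_arcs:
  assumes V: "u \<in> {1..n}" "v \<in> {1..n}" "u \<noteq> v"
  shows "card (sinks_arcs n u v) = 2 * n - 3" "card (sources_arcs n u v) = 2 * n - 3"
    "card (ends_arcs n u v) = 2 * n - 3"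
proof -
  have c: "card ({1..n} - {u, v}) = n - 2" using V by (simp add: card_Diff_subset)
  have n: "n \<ge> 2" using V by auto
  have "card (sinks_arcs n u v) = (n - 1) + (n - 2)"
    unfolding sinks_arcs_def using V c
    by (subst card_Un_disjoint) (auto simp: sink_arcs_def card_cartesian_product)
  moreover have "card (sources_arcs n u v) = (n - 1) + (n - 2)"
    unfolding sources_arcs_def using V c
    by (subst card_Un_disjoint) (auto simp: source_arcs_def card_cartesian_product)
  moreover have "card (ends_arcs n u v) = (n - 1) + (n - 2)"
    unfolding ends_arcs_def using V c
    by (subst card_Un_disjoint) (auto simp: sink_arcs_def card_cartesian_product)
  ultimately show "card (sinks_arcs n u v) = 2 * n - 3" "card (sources_arcs n u v) = 2 * n - 3"
    "card (ends_arcs n u v) = 2 * n - 3" using n by linarith+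
qed

lemma prob_pair:
  assumes m: "m \<le> n choose 2" and V: "u \<in> {1..n}" "v \<in> {1..n}" "u \<noteq> v"
  shows "measure_pmf.prob (directed_gnm n m) (avoiding (sinks_arcs n u v)) = one_way_prob (n choose 2) m (2 * n - 3)"
    and "measure_pmf.prob (directed_gnm n m) (avoiding (sources_arcs n u v)) = one_way_prob (n choose 2) m (2 * n - 3)"
    and "measure_pmf.prob (directed_gnm n m) (avoiding (ends_arcs n u v)) = one_way_prob (n choose 2) m (2 * n - 3)"
proof -
  have "sinks_arcs n u v \<subseteq> arcs n" "sources_arcs n u v \<subseteq> arcs n" "ends_arcs n u v \<subseteq> arcs n"
    using V by (auto simp: sinks_arcs_def sources_arcs_def ends_arcs_def sink_arcs_def source_arcs_def arcs_def)
  moreover have "sinks_arcs n u v \<inter> (sinks_arcs n u v)\<inverse> = {}" "sources_arcs n u v \<inter> (sources_arcs n u v)\<inverse> = {}"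
      "ends_arcs n u v \<inter> (ends_arcs n u v)\<inverse> = {}"
    using V by (auto simp: sinks_arcs_def sources_arcs_def ends_arcs_def sink_arcs_def source_arcs_def)
  ultimately show "measure_pmf.prob (directed_gnm n m) (avoiding (sinks_arcs n u v)) = one_way_prob (n choose 2) m (2 * n - 3)"
    "measure_pmf.prob (directed_gnm n m) (avoiding (sources_arcs n u v)) = one_way_prob (n choose 2) m (2 * n - 3)"
    "measure_pmf.prob (directed_gnm n m) (avoiding (ends_arcs n u v)) = one_way_prob (n choose 2) m (2 * n - 3)"
    using prob_avoiding_one_way[OF m] card_pair_arcs[OF V] by metis+
qed

lemma prob_Un_ge:
  "measure_pmf.prob M (A \<union> B) \<ge> measure_pmf.prob M A + measure_pmf.prob M B - measure_pmf.prob M (A \<inter> B)"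
  by (simp add: measure_Un3 measure_pmf.fmeasurable_eq_sets)

lemma prob_Un3_ge:
  "measure_pmf.prob M (A \<union> B \<union> C) \<ge> measure_pmf.prob M A + measure_pmf.prob M B + measure_pmf.prob M C
     - measure_pmf.prob M (A \<inter> B) - measure_pmf.prob M (A \<inter> C) - measure_pmf.prob M (B \<inter> C)"
proof -
  have "measure_pmf.prob M ((A \<union> B) \<inter> C) \<le> measure_pmf.prob M (A \<inter> C) + measure_pmf.prob M (B \<inter> C)"
    unfolding Int_Un_distrib2 by (rule measure_subadditive) auto
  then show ?thesis using prob_Un_ge[of M A B] prob_Un_ge[of M "A \<union> B" C] by linarith
qed

lemma prob_no_path_upper:
  assumes m: "m \<le> n choose 2" and V: "s \<in> {1..n}" "a \<in> {1..n}"
  shows "measure_pmf.prob (directed_gnm n m) (no_path_event s a)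
    \<le> 2 * one_way_prob (n choose 2) m (n - 1) + measure_pmf.prob (directed_gnm n m) (mid_closed n 1)"
proof -
  let ?P = "measure_pmf.prob (directed_gnm n m)"
  have "?P (no_path_event s a) \<le> ?P (avoiding (sink_arcs n s) \<union> avoiding (source_arcs n a) \<union> mid_closed n 1)"
    using no_path_event_subset[OF V] by (intro measure_pmf.finite_measure_mono) auto
  also have "\<dots> \<le> ?P (avoiding (sink_arcs n s)) + ?P (avoiding (source_arcs n a)) + ?P (mid_closed n 1)"
    by (intro order.trans[OF measure_subadditive] add_mono measure_subadditive order_refl) auto
  finally show ?thesis using prob_sink[OF m V(1)] prob_source[OF m V(2)] by simp
qed

lemma prob_no_path_lower:
  assumes m: "m \<le> n choose 2" and V: "s \<in> {1..n}" "a \<in> {1..n}" "s \<noteq> a"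
  shows "measure_pmf.prob (directed_gnm n m) (no_path_event s a)
    \<ge> 2 * one_way_prob (n choose 2) m (n - 1) - (1 - m / (2 * (n choose 2))) ^ (2 * (n - 2))"
proof -
  let ?P = "measure_pmf.prob (directed_gnm n m)"
  have "D \<in> no_path_event s a"
    if "D \<in> set_pmf (directed_gnm n m)" "D \<in> avoiding (sink_arcs n s) \<union> avoiding (source_arcs n a)" for D
  proof -
    have D: "D \<subseteq> arcs n" by (rule directed_gnm_subset_arcs[OF m that(1)])
    from that(2) show ?thesis
    proof
      assume "D \<in> avoiding (sink_arcs n s)"
      then have "out_closed n D {s}"
        using V(1) unfolding avoiding_def sink_arcs_def out_closed_iff by blast
      then show ?thesis by (rule no_path_if_out_closed[OF D]) (use V in auto)
    next
      assume "D \<in> avoiding (source_arcs n a)"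
      then have "out_closed n D ({1..n} - {a})"
        unfolding avoiding_def source_arcs_def out_closed_iff by blast
      then show ?thesis by (rule no_path_if_out_closed[OF D]) (use V in auto)
    qed
  qed
  then have "?P (avoiding (sink_arcs n s) \<union> avoiding (source_arcs n a)) \<le> ?P (no_path_event s a)"
    by (intro measure_pmf.finite_measure_mono_AE) (auto simp: AE_measure_pmf_iff)
  moreover have "?P (avoiding (sink_arcs n s) \<inter> avoiding (source_arcs n a))
      \<le> (1 - m / (2 * (n choose 2))) ^ ((card {s} + card {a}) * card ({1..n} - {s, a}))"
    unfolding avoiding_Un[symmetric] using V
    by (intro prob_avoiding_biclique_le[OF m]) (auto simp: sink_arcs_def source_arcs_def)
  moreover have "card ({1..n} - {s, a}) = n - 2" using V by (simp add: card_Diff_subset)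
  ultimately show ?thesis
    using prob_Un_ge[of "directed_gnm n m" "avoiding (sink_arcs n s)" "avoiding (source_arcs n a)"]
      prob_sink[OF m V(1)] prob_source[OF m V(2)] by (simp add: numeral_2_eq_2)
qed

lemma prob_no_paths_upper:
  assumes m: "m \<le> n choose 2" and n: "n \<ge> 7"
    and V: "s \<in> {1..n}" "a \<in> {1..n}" "b \<in> {1..n}" and dist: "distinct [s, a, b]"
  shows "measure_pmf.prob (directed_gnm n m) (no_path_event s a \<inter> no_path_event b s)
    \<le> 3 * one_way_prob (n choose 2) m (2 * n - 3) + measure_pmf.prob (directed_gnm n m) (mid_closed n 2)
      + measure_pmf.prob (directed_gnm n m) (small_pair n) + (1 - m / (n choose 2)) ^ (n - 1)"
proof -
  let ?P = "measure_pmf.prob (directed_gnm n m)"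
  have "?P (no_path_event s a \<inter> no_path_event b s) \<le> ?P (avoiding (sinks_arcs n s b) \<union> avoiding (sources_arcs n s a)
     \<union> avoiding (ends_arcs n a b) \<union> mid_closed n 2 \<union> small_pair n \<union> avoiding (isolating_arcs n s))"
    using no_path_events_subset[OF n V dist] by (intro measure_pmf.finite_measure_mono) auto
  also have "\<dots> \<le> ?P (avoiding (sinks_arcs n s b)) + ?P (avoiding (sources_arcs n s a))
     + ?P (avoiding (ends_arcs n a b)) + ?P (mid_closed n 2) + ?P (small_pair n) + ?P (avoiding (isolating_arcs n s))"
    by (intro order.trans[OF measure_subadditive] add_mono measure_subadditive order_refl) auto
  finally show ?thesis
    using prob_pair[OF m] V dist prob_isolated_le[OF m V(1)] unfolding isolating_arcs_def by fastforce
qed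

text \<open>
  Two of the three configurations together forbid at least \<open>3 * (n - 3)\<close> arcs between \<open>{s, a, b}\<close> and the
  other vertices, so the overlaps in Bonferroni's inequality are negligible.
\<close>
lemma prob_no_paths_lower:
  assumes m: "m \<le> n choose 2"
    and V: "s \<in> {1..n}" "a \<in> {1..n}" "b \<in> {1..n}" and dist: "distinct [s, a, b]"
  shows "measure_pmf.prob (directed_gnm n m) (no_path_event s a \<inter> no_path_event b s)
    \<ge> 3 * one_way_prob (n choose 2) m (2 * n - 3) - 3 * (1 - m / (2 * (n choose 2))) ^ (3 * (n - 3))"
proof -
  let ?P = "measure_pmf.prob (directed_gnm n m)" and ?r = "1 - m / (2 * (n choose 2))"
  let ?A = "avoiding (sinks_arcs n s b)" and ?B = "avoiding (sources_arcs n s a)" and ?C = "avoiding (ends_arcs n a b)"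
  have "D \<in> no_path_event s a \<inter> no_path_event b s"
    if "D \<in> set_pmf (directed_gnm n m)" "D \<in> ?A \<union> ?B \<union> ?C" for D
  proof -
    have D: "D \<subseteq> arcs n" by (rule directed_gnm_subset_arcs[OF m that(1)])
    from \<open>D \<in> ?A \<union> ?B \<union> ?C\<close> consider "out_closed n D {s, b}" "out_closed n D {b}"
      | "out_closed n D ({1..n} - {a})" "out_closed n D ({1..n} - {a, s})"
      | "out_closed n D ({1..n} - {a})" "out_closed n D {b}"
    proof (elim UnE)
      assume "D \<in> ?A"
      then have "out_closed n D {s, b}" "out_closed n D {b}"
        using V unfolding avoiding_def sinks_arcs_def sink_arcs_def out_closed_iff by blast+
      then show thesis by (rule that)
    next
      assume "D \<in> ?B"
      then have "out_closed n D ({1..n} - {a})" "out_closed n D ({1..n} - {a, s})"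
        using V unfolding avoiding_def sources_arcs_def source_arcs_def out_closed_iff by blast+
      then show thesis by (rule that)
    next
      assume "D \<in> ?C"
      then have "out_closed n D ({1..n} - {a})" "out_closed n D {b}"
        using V unfolding avoiding_def ends_arcs_def sink_arcs_def out_closed_iff by blast+
      then show thesis by (rule that)
    qed
    then show ?thesis
    proof cases
      case 1
      then show ?thesis using no_path_if_out_closed[OF D, of "{s, b}" s a] no_path_if_out_closed[OF D, of "{b}" b s] V dist by auto
    next
      case 2
      then show ?thesis using no_path_if_out_closed[OF D, of "{1..n} - {a}" s a]
          no_path_if_out_closed[OF D, of "{1..n} - {a, s}" b s] V dist by auto
    next
      case 3
      then show ?thesis using no_path_if_out_closed[OF D, of "{1..n} - {a}" s a]
          no_path_if_out_closed[OF D, of "{b}" b s] V dist by auto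
    qed
  qed
  then have le: "?P (?A \<union> ?B \<union> ?C) \<le> ?P (no_path_event s a \<inter> no_path_event b s)"
    by (intro measure_pmf.finite_measure_mono_AE) (auto simp: AE_measure_pmf_iff)
  let ?W = "{1..n} - {s, a, b}"
  have W: "card ?W = n - 3" using V dist by (simp add: card_Diff_subset)
  have AB: "?P (?A \<inter> ?B) \<le> ?r ^ ((card {s, b} + card {a}) * card ?W)"
    unfolding avoiding_Un[symmetric] using V dist
    by (intro prob_avoiding_biclique_le[OF m])
       (auto simp: sinks_arcs_def sources_arcs_def ends_arcs_def sink_arcs_def source_arcs_def)
  have AC: "?P (?A \<inter> ?C) \<le> ?r ^ ((card {s, b} + card {a}) * card ?W)"
    unfolding avoiding_Un[symmetric] using V dist
    by (intro prob_avoiding_biclique_le[OF m])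
       (auto simp: sinks_arcs_def sources_arcs_def ends_arcs_def sink_arcs_def source_arcs_def)
  have BC: "?P (?B \<inter> ?C) \<le> ?r ^ ((card {b} + card {a, s}) * card ?W)"
    unfolding avoiding_Un[symmetric] using V dist
    by (intro prob_avoiding_biclique_le[OF m])
       (auto simp: sinks_arcs_def sources_arcs_def ends_arcs_def sink_arcs_def source_arcs_def)
  have three: "card {s, b} + card {a} = 3" "card {b} + card {a, s} = 3" using dist by auto
  show ?thesis
    using le prob_Un3_ge[of "directed_gnm n m" ?A ?B ?C] AB AC BC prob_pair[OF m] V dist
    unfolding three W by fastforce
qed

section \<open>Asymptotics of the avoidance probability\<close>


lemma real_choose_two: "real (n choose 2) = real n * (real n - 1) / 2"
proof (induction n)
  case (Suc n)
  have "Suc n choose 2 = n + (n choose 2)" by (simp add: numeral_2_eq_2)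
  then show ?case using Suc by (simp add: field_simps)
qed (simp add: numeral_2_eq_2)

text \<open>
  A product of \<open>n - 2\<close> factors \<open>1 + c/n + o(1/n)\<close> tends to \<open>exp c\<close>. The error has to be uniform in the
  index of the factor; this is expressed by the same limit along every choice \<open>j\<close> of indices, and the
  proof applies it to a choice that maximizes the error.
\<close>
lemma prod_tendsto_exp:
  fixes a :: "nat \<Rightarrow> nat \<Rightarrow> real"
  assumes unif: "\<And>j. (\<And>n. n \<ge> 3 \<Longrightarrow> j n < n - 2) \<Longrightarrow> (\<lambda>n. real n * (a n (j n) - 1)) \<longlonglongrightarrow> c"
  shows "(\<lambda>n. \<Prod>i<n - 2. a n i) \<longlonglongrightarrow> exp c"
proof -
  define g where "g n i = \<bar>real n * (a n i - 1) - c\<bar>" for n i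
  have "\<exists>j. \<forall>n\<ge>3. j n < n - 2 \<and> (\<forall>i<n - 2. g n i \<le> g n (j n))"
  proof -
    have "\<exists>k. n \<ge> 3 \<longrightarrow> k < n - 2 \<and> (\<forall>i<n - 2. g n i \<le> g n k)" for n
    proof (cases "n \<ge> 3")
      case True
      then have "Max (g n ` {..<n - 2}) \<in> g n ` {..<n - 2}" by (intro Max_in) (auto simp: lessThan_empty_iff)
      then obtain k where k: "k < n - 2" "Max (g n ` {..<n - 2}) = g n k" by auto
      have "g n i \<le> g n k" if "i < n - 2" for i
        unfolding k(2)[symmetric] using that by (intro Max_ge) auto
      with k show ?thesis by blast
    qed auto
    then show ?thesis by metis
  qed
  then obtain j where j: "\<And>n. n \<ge> 3 \<Longrightarrow> j n < n - 2" "\<And>n i. n \<ge> 3 \<Longrightarrow> i < n - 2 \<Longrightarrow> g n i \<le> g n (j n)"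
    by blast
  define \<delta> where "\<delta> n = g n (j n)" for n
  have \<delta>: "\<delta> \<longlonglongrightarrow> 0"
    using tendsto_rabs_zero[OF LIM_zero[OF unif[OF j(1)]]] by (simp add: \<delta>_def[abs_def] g_def)
  let ?B = "\<lambda>n. 2 * (\<bar>c\<bar> + \<delta> n)\<^sup>2 / real n + \<delta> n + \<bar>c\<bar> * (2 / real n)"
  have B0: "?B \<longlonglongrightarrow> 2 * (\<bar>c\<bar> + 0)\<^sup>2 * 0 + 0 + \<bar>c\<bar> * 0"
    unfolding divide_inverse[of _ "real _"]
    by (intro tendsto_intros \<delta> lim_inverse_n tendsto_mult_right_zero)
  have small: "eventually (\<lambda>n. (\<bar>c\<bar> + \<delta> n) * inverse (real n) < 1 / 2) sequentially"
    by (rule order_tendstoD(2)[of _ "(\<bar>c\<bar> + 0) * 0"]) (intro tendsto_intros \<delta> lim_inverse_n, simp)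
  have bound: "eventually (\<lambda>n. 0 < (\<Prod>i<n - 2. a n i) \<and> \<bar>ln (\<Prod>i<n - 2. a n i) - c\<bar> \<le> ?B n) sequentially"
    using small eventually_ge_at_top[of 3]
  proof eventually_elim
    case (elim n)
    define x where "x i = a n i - 1" for i
    have x: "\<bar>real n * x i - c\<bar> \<le> \<delta> n" "\<bar>x i\<bar> \<le> (\<bar>c\<bar> + \<delta> n) / n" "\<bar>x i\<bar> \<le> 1 / 2" if "i < n - 2" for i
    proof -
      show 1: "\<bar>real n * x i - c\<bar> \<le> \<delta> n"
        using j(2)[OF elim(2) that] by (simp add: \<delta>_def g_def x_def)
      then have "\<bar>real n * x i\<bar> \<le> \<bar>c\<bar> + \<delta> n" by linarith
      then show 2: "\<bar>x i\<bar> \<le> (\<bar>c\<bar> + \<delta> n) / n"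
        using elim(2) by (simp add: abs_mult pos_le_divide_eq mult.commute)
      also have "\<dots> \<le> 1 / 2" using elim(1) unfolding divide_inverse[of "_ + _"] by linarith
      finally show "\<bar>x i\<bar> \<le> 1 / 2" .
    qed
    have pos: "0 < a n i" if "i < n - 2" for i using x(3)[OF that] by (simp add: x_def abs_if split: if_splits)
    have lnsum: "ln (\<Prod>i<n - 2. a n i) = (\<Sum>i<n - 2. ln (1 + x i))"
      by (subst ln_prod) (auto simp: x_def dest: pos)
    have "\<bar>(\<Sum>i<n - 2. ln (1 + x i)) - (\<Sum>i<n - 2. x i)\<bar> \<le> (\<Sum>i<n - 2. \<bar>ln (1 + x i) - x i\<bar>)"
      unfolding sum_subtractf[symmetric] by (rule sum_abs)
    also have "\<dots> \<le> (\<Sum>i<n - 2. 2 * ((\<bar>c\<bar> + \<delta> n) / n)\<^sup>2)"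
    proof (rule sum_mono)
      fix i assume i: "i \<in> {..<n - 2}"
      then have "\<bar>ln (1 + x i) - x i\<bar> \<le> 2 * (x i)\<^sup>2"
        using x(3) by (intro abs_ln_one_plus_x_minus_x_bound) auto
      also have "(x i)\<^sup>2 \<le> ((\<bar>c\<bar> + \<delta> n) / n)\<^sup>2"
        using x(2)[of i] i by (subst power2_abs[symmetric], intro power_mono) auto
      finally show "\<bar>ln (1 + x i) - x i\<bar> \<le> 2 * ((\<bar>c\<bar> + \<delta> n) / n)\<^sup>2" by simp
    qed
    also have "\<dots> \<le> real n * (2 * ((\<bar>c\<bar> + \<delta> n) / n)\<^sup>2)"
      using elim by (simp add: mult_right_mono)
    also have "\<dots> = 2 * (\<bar>c\<bar> + \<delta> n)\<^sup>2 / n"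
      using elim by (simp add: power2_eq_square field_simps)
    finally have A1: "\<bar>(\<Sum>i<n - 2. ln (1 + x i)) - (\<Sum>i<n - 2. x i)\<bar> \<le> 2 * (\<bar>c\<bar> + \<delta> n)\<^sup>2 / n" .
    have "\<bar>(\<Sum>i<n - 2. x i) - (\<Sum>i<n - 2. c / n)\<bar> \<le> (\<Sum>i<n - 2. \<bar>x i - c / n\<bar>)"
      unfolding sum_subtractf[symmetric] by (rule sum_abs)
    also have "\<dots> \<le> (\<Sum>i<n - 2. \<delta> n / n)"
    proof (rule sum_mono)
      fix i assume i: "i \<in> {..<n - 2}"
      have "x i - c / n = (real n * x i - c) / n" using elim by (simp add: diff_divide_distrib)
      then have "\<bar>x i - c / n\<bar> = \<bar>real n * x i - c\<bar> / n" by (simp only: abs_divide abs_of_nat)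
      also have "\<dots> \<le> \<delta> n / n" using x(1)[of i] i by (intro divide_right_mono) auto
      finally show "\<bar>x i - c / n\<bar> \<le> \<delta> n / n" .
    qed
    also have "\<dots> \<le> real n * (\<delta> n / n)"
      unfolding sum_constant card_lessThan by (intro mult_right_mono) (auto simp: \<delta>_def g_def)
    also have "\<dots> = \<delta> n" using elim by simp
    finally have A2: "\<bar>(\<Sum>i<n - 2. x i) - (\<Sum>i<n - 2. c / n)\<bar> \<le> \<delta> n" .
    have "(\<Sum>i<n - 2. c / n) - c = - (c * (2 / n))"
      using elim by (simp add: of_nat_diff field_simps)
    then have A3: "\<bar>(\<Sum>i<n - 2. c / n) - c\<bar> = \<bar>c\<bar> * (2 / n)"
      by (simp add: abs_mult)
    have tri: "\<bar>s1 - c'\<bar> \<le> e1 + e2 + e3"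
      if "\<bar>s1 - s2\<bar> \<le> e1" "\<bar>s2 - s3\<bar> \<le> e2" "\<bar>s3 - c'\<bar> = e3" for s1 s2 s3 c' e1 e2 e3 :: real
      using that by linarith
    show ?case
    proof
      show "0 < (\<Prod>i<n - 2. a n i)" by (intro prod_pos) (auto dest: pos)
      show "\<bar>ln (\<Prod>i<n - 2. a n i) - c\<bar> \<le> ?B n" unfolding lnsum by (rule tri[OF A1 A2 A3])
    qed
  qed
  have "(\<lambda>n. ln (\<Prod>i<n - 2. a n i) - c) \<longlonglongrightarrow> 0"
  proof (rule Lim_null_comparison[of _ ?B])
    show "\<forall>\<^sub>F n in sequentially. norm (ln (\<Prod>i<n - 2. a n i) - c) \<le> ?B n"
      using bound by eventually_elim (simp only: real_norm_def)
    show "?B \<longlonglongrightarrow> 0"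
      using B0 by (simp only: mult_zero_right add_0_left add_0_right)
  qed
  then have "(\<lambda>n. exp (ln (\<Prod>i<n - 2. a n i))) \<longlonglongrightarrow> exp c"
    by (rule tendsto_exp[OF LIM_zero_cancel])
  then show ?thesis
  proof (rule Lim_transform_eventually)
    show "\<forall>\<^sub>F n in sequentially. exp (ln (\<Prod>i<n - 2. a n i)) = (\<Prod>i<n - 2. a n i)"
      using bound by eventually_elim (simp only: exp_ln)
  qed
qed

text \<open>
  Inside, \<open>q\<close> is the edge density, \<open>r = 1 - q/2\<close> the price of a forbidden arc, \<open>F\<close> the avoidance
  probability and \<open>f\<close> the sequence of its consecutive ratios.
\<close>
locale dense_edges =
  fixes m :: "nat \<Rightarrow> nat" and p :: real
  assumes m_le: "\<And>n. m n \<le> n choose 2"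
    and density: "(\<lambda>n. real (m n) / real (n choose 2)) \<longlonglongrightarrow> p"
    and p_pos: "0 < p" and p_le: "p \<le> 1"
begin

definition q :: "nat \<Rightarrow> real" where "q n = real (m n) / real (n choose 2)"
definition r :: "nat \<Rightarrow> real" where "r n = 1 - q n / 2"
definition f :: "nat \<Rightarrow> nat \<Rightarrow> real" where "f n = avoid_ratio (n choose 2) (m n)"
definition F :: "nat \<Rightarrow> nat \<Rightarrow> real" where "F n = one_way_prob (n choose 2) (m n)"

lemma q_bounds: "0 \<le> q n" "q n \<le> 1"
  using m_le[of n] by (auto simp: q_def divide_simps)

lemma r_bounds: "1 / 2 \<le> r n" "r n \<le> 1"
  using q_bounds[of n] by (auto simp: r_def)

lemma r_eq: "1 - real (m n) / (2 * real (n choose 2)) = r n" "1 - real (m n) / real (2 * (n choose 2)) = r n"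
  by (simp_all add: r_def q_def)

lemma r_tendsto: "r \<longlonglongrightarrow> 1 - p / 2"
  unfolding r_def q_def by (intro tendsto_intros density) simp

lemma slots_gt: "n \<ge> 8 \<Longrightarrow> 2 * n < n choose 2"
proof -
  assume n: "n \<ge> 8"
  then have "real n * 7 \<le> real n * (real n - 1)" by (intro mult_left_mono) auto
  then have "real (2 * n) < real (n choose 2)" using n unfolding real_choose_two by simp
  then show "2 * n < n choose 2" by (simp only: of_nat_less_iff)
qed

lemma slot_fraction_tendsto_0:
  assumes "\<And>n. k n \<le> 2 * n"
  shows "(\<lambda>n. real (k n) / real ((n choose 2) - k n)) \<longlonglongrightarrow> 0"
proof (rule tendsto_sandwich[of "\<lambda>_. 0"])
  show "(\<lambda>n. 2 * real n / (real n * (real n - 1) / 2 - 2 * real n)) \<longlonglongrightarrow> 0" by real_asymp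
  show "\<forall>\<^sub>F n in sequentially. real (k n) / real ((n choose 2) - k n) \<le> 2 * real n / (real n * (real n - 1) / 2 - 2 * real n)"
    using eventually_ge_at_top[of 8]
  proof eventually_elim
    case (elim n)
    have k: "real (k n) \<le> 2 * real n" using assms[of n] by linarith
    have less: "2 * real n < real (n choose 2)" using slots_gt[OF elim] by linarith
    have "real ((n choose 2) - k n) = real (n choose 2) - real (k n)"
      using slots_gt[OF elim] assms[of n] by (intro of_nat_diff) auto
    then show ?case using k less unfolding real_choose_two[symmetric]
      by (intro frac_le) auto
  qed
qed auto

lemma f_tendsto:
  assumes "\<And>n. k n \<le> 2 * n"
  shows "(\<lambda>n. f n (k n)) \<longlonglongrightarrow> 1 - p / 2"
proof (rule tendsto_sandwich[OF _ _ _ r_tendsto])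
  show "\<forall>\<^sub>F n in sequentially. f n (k n) \<le> r n"
    using eventually_ge_at_top[of 8]
  proof eventually_elim
    case (elim n)
    have "k n < n choose 2" using slots_gt[OF elim] assms[of n] by linarith
    then show ?case using avoid_ratio_le[of "k n" "n choose 2" "m n"] m_le[of n] unfolding f_def by (simp add: r_def q_def)
  qed
  show "\<forall>\<^sub>F n in sequentially. 1 - q n / 2 * (1 + real (k n) / real ((n choose 2) - k n)) \<le> f n (k n)"
    using eventually_ge_at_top[of 8]
  proof eventually_elim
    case (elim n)
    have k: "k n < n choose 2" using slots_gt[OF elim] assms[of n] by linarith
    have "q n / 2 * (1 + real (k n) / real ((n choose 2) - k n)) = m n / (2 * real ((n choose 2) - k n))"
      using k elim by (simp add: q_def of_nat_diff field_simps)
    then show ?case using avoid_ratio_ge[OF k m_le] unfolding f_def by simp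
  qed
  have "(\<lambda>n. 1 - q n / 2 * (1 + real (k n) / real ((n choose 2) - k n))) \<longlonglongrightarrow> 1 - p / 2 * (1 + 0)"
    using density unfolding q_def[symmetric]
    by (intro tendsto_intros slot_fraction_tendsto_0 assms) auto
  then show "(\<lambda>n. 1 - q n / 2 * (1 + real (k n) / real ((n choose 2) - k n))) \<longlonglongrightarrow> 1 - p / 2" by simp
qed

text \<open>
  Shifting the index by \<open>n - 1\<close> changes \<open>K / (2 * (N - K))\<close> by about \<open>(n - 1) / (2 * N) = 1 / n\<close>, while
  the other factor in \<open>avoid_ratio_recurrence\<close> tends to the stated constant. In the proof,
  \<open>n * K / (2 * (N - K))\<close> is split as \<open>K / (n - 1) + C n K\<close>, where \<open>C\<close> tends to 0, and \<open>u\<close> is the other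
  factor.
\<close>
lemma f_increment_tendsto:
  assumes j: "\<And>n. j n \<le> n"
  shows "(\<lambda>n. real n * (f n (n - 1 + j n) - f n (j n))) \<longlonglongrightarrow> 1 / (1 - p / 2) - 1 - p"
proof -
  define \<kappa> where "\<kappa> = 1 / (1 - p / 2) - 1 - p"
  define C where "C n K = real n * real K / (2 * real (n choose 2)) * (real K / real ((n choose 2) - K))" for n K
  define u where "u n K = 1 / f n (K - 1) - 1 - q n" for n K
  have u: "(\<lambda>n. u n (k n)) \<longlonglongrightarrow> \<kappa>" if "\<And>n. k n \<le> 2 * n" for k
    unfolding u_def \<kappa>_def
  proof (intro tendsto_intros f_tendsto)
    show "k n - 1 \<le> 2 * n" for n using that[of n] by linarith
    show "q \<longlonglongrightarrow> p" using density unfolding q_def[symmetric] .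
  qed (use p_le in auto)
  have C: "(\<lambda>n. C n (k n)) \<longlonglongrightarrow> 0" if k: "\<And>n. k n \<le> 2 * n" for k
  proof (rule Lim_null_comparison)
    have "(\<lambda>n. 3 * (real (k n) / real ((n choose 2) - k n))) \<longlonglongrightarrow> 3 * 0"
      by (intro tendsto_intros slot_fraction_tendsto_0 k)
    then show "(\<lambda>n. 3 * (real (k n) / real ((n choose 2) - k n))) \<longlonglongrightarrow> 0" by simp
    show "\<forall>\<^sub>F n in sequentially. norm (C n (k n)) \<le> 3 * (real (k n) / real ((n choose 2) - k n))"
      using eventually_ge_at_top[of 8]
    proof eventually_elim
      case (elim n)
      have "real n * real (k n) \<le> real n * (2 * real n)" using k[of n] by (intro mult_left_mono) auto
      also have "\<dots> \<le> real n * (3 * (real n - 1))" using elim by (intro mult_left_mono) auto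
      finally have "real n * real (k n) \<le> 3 * (2 * real (n choose 2))"
        unfolding real_choose_two by (simp add: algebra_simps)
      moreover have "real (n choose 2) > 0" using slots_gt[OF elim] by linarith
      ultimately have "real n * real (k n) / (2 * real (n choose 2)) \<le> 3"
        by (simp add: pos_divide_le_eq)
      then have "C n (k n) \<le> 3 * (real (k n) / real ((n choose 2) - k n))"
        unfolding C_def by (intro mult_right_mono) auto
      then show ?case by (simp add: C_def)
    qed
  qed
  let ?j1 = "\<lambda>n. n - 1 + j n"
  have j1: "?j1 n \<le> 2 * n" and j0: "j n \<le> 2 * n" for n using j[of n] by linarith+
  have main: "(\<lambda>n. ((1 + C n (?j1 n) - C n (j n)) * u n (?j1 n) + C n (j n) * (u n (?j1 n) - u n (j n)))
        + (j n / (real n - 1)) * (u n (?j1 n) - u n (j n))) \<longlonglongrightarrow> \<kappa>"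
  proof -
    have L1: "(\<lambda>n. (j n / (real n - 1)) * (u n (?j1 n) - u n (j n))) \<longlonglongrightarrow> 0"
    proof (rule Lim_null_comparison)
      have "(\<lambda>n. 2 * \<bar>u n (?j1 n) - u n (j n)\<bar>) \<longlonglongrightarrow> 2 * \<bar>\<kappa> - \<kappa>\<bar>"
        by (intro tendsto_intros u j1 j0)
      then show "(\<lambda>n. 2 * \<bar>u n (?j1 n) - u n (j n)\<bar>) \<longlonglongrightarrow> 0" by simp
      show "\<forall>\<^sub>F n in sequentially. norm (j n / (real n - 1) * (u n (?j1 n) - u n (j n))) \<le> 2 * \<bar>u n (?j1 n) - u n (j n)\<bar>"
        using eventually_ge_at_top[of 8]
      proof eventually_elim
        case (elim n)
        have "\<bar>j n / (real n - 1)\<bar> \<le> 2" using j[of n] elim by (simp add: divide_le_eq)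
        then show ?case unfolding real_norm_def abs_mult by (intro mult_right_mono) auto
      qed
    qed
    have L2: "(\<lambda>n. (1 + C n (?j1 n) - C n (j n)) * u n (?j1 n) + C n (j n) * (u n (?j1 n) - u n (j n)))
        \<longlonglongrightarrow> (1 + 0 - 0) * \<kappa> + 0 * (\<kappa> - \<kappa>)"
      by (intro tendsto_add tendsto_mult tendsto_diff tendsto_const u[of ?j1, OF j1] u[of j, OF j0]
          C[of ?j1, OF j1] C[of j, OF j0])
    show ?thesis using tendsto_add[OF L2 L1] by simp
  qed
  have step: "real n * (f n K - r n) = (K / (real n - 1) + C n K) * u n K" if n: "n \<ge> 8" and K: "K \<le> 2 * n" for n K
  proof -
    have less: "K < n choose 2" using slots_gt[OF n] K by linarith
    have "f n K - r n = K / (2 * real ((n choose 2) - K)) * u n K"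
      using avoid_ratio_recurrence[OF less m_le[of n]] unfolding f_def u_def r_def q_def by simp
    then have "real n * (f n K - r n) = (real n * K / (2 * real ((n choose 2) - K))) * u n K" by simp
    also have "real n * K / (2 * real ((n choose 2) - K)) = K / (real n - 1) + C n K"
    proof -
      have D: "real ((n choose 2) - K) = real (n choose 2) - K" "real (n choose 2) - K > 0" "real (n choose 2) > 0"
        using less n by auto
      have "real n * K / (2 * real ((n choose 2) - K)) = real n * K / (2 * real (n choose 2)) + C n K"
        using D(2,3) unfolding C_def D(1) by (simp add: field_simps)
      also have "real n * K / (2 * real (n choose 2)) = K / (real n - 1)"
        using n unfolding real_choose_two by simp
      finally show ?thesis .
    qed
    finally show ?thesis .
  qed
  have "\<forall>\<^sub>F n in sequentially. ((1 + C n (?j1 n) - C n (j n)) * u n (?j1 n) + C n (j n) * (u n (?j1 n) - u n (j n)))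
        + (j n / (real n - 1)) * (u n (?j1 n) - u n (j n)) = real n * (f n (n - 1 + j n) - f n (j n))"
    using eventually_ge_at_top[of 8]
  proof eventually_elim
    case (elim n)
    have "real (?j1 n) = (real n - 1) + j n" using elim by (simp add: of_nat_diff)
    then have "real (?j1 n) / (real n - 1) = 1 + j n / (real n - 1)"
      using elim by (simp only: add_divide_distrib) simp
    then have "real n * (f n (n - 1 + j n) - f n (j n))
        = (1 + j n / (real n - 1) + C n (?j1 n)) * u n (?j1 n) - (j n / (real n - 1) + C n (j n)) * u n (j n)"
      using step[OF elim j1] step[OF elim j0] by (simp add: algebra_simps)
    then show ?case by (simp add: algebra_simps)
  qed
  with main show ?thesis unfolding \<kappa>_def by (rule Lim_transform_eventually)
qed

lemma F_pos: "n \<ge> 8 \<Longrightarrow> K \<le> 2 * n \<Longrightarrow> 0 < F n K"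
  unfolding F_def using slots_gt[of n] m_le[of n] by (intro one_way_prob_pos) auto

lemma F_add: "n \<ge> 8 \<Longrightarrow> K + j \<le> 2 * n \<Longrightarrow> F n (K + j) = F n K * (\<Prod>i<j. f n (K + i))"
  unfolding F_def f_def using slots_gt[of n] m_le[of n] by (intro one_way_prob_add) auto

lemma F_eq_prod: "n \<ge> 8 \<Longrightarrow> F n (n - 1) = (\<Prod>i<n - 1. f n i)"
  using F_add[of n 0 "n - 1"] one_way_prob_0[OF m_le[of n]] by (simp add: F_def)

lemma f_pos: "n \<ge> 8 \<Longrightarrow> K \<le> 2 * n \<Longrightarrow> 0 < f n K"
  unfolding f_def using slots_gt[of n] m_le[of n] by (intro avoid_ratio_pos) auto

text \<open>
  The numerator has the consecutive ratios with indices below \<open>2 * n - 3\<close>, and each factor in the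
  denominator those below \<open>n - 1\<close>. After cancelling one factor, the ratios with index \<open>n - 1 + i\<close> are
  compared with those with index \<open>i\<close>, and one unmatched ratio, near \<open>1 - p/2\<close>, is left in the
  denominator. The exponential is the effect of conditioning on the number of edges.
\<close>
lemma F_ratio_tendsto:
  "(\<lambda>n. F n (2 * n - 3) / (F n (n - 1))\<^sup>2) \<longlonglongrightarrow> exp (- (2 * p * (1 - p) / (2 - p)\<^sup>2)) / (1 - p / 2)"
proof -
  define \<kappa> where "\<kappa> = 1 / (1 - p / 2) - 1 - p"
  have p2: "1 - p / 2 > 0" using p_le by simp
  have "(\<lambda>n. \<Prod>i<n - 2. f n (n - 1 + i) / f n i) \<longlonglongrightarrow> exp (\<kappa> / (1 - p / 2))"
  proof (rule prod_tendsto_exp)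
    fix j :: "nat \<Rightarrow> nat" assume j: "\<And>n. n \<ge> 3 \<Longrightarrow> j n < n - 2"
    \<comment> \<open>arbitrary for the finitely many n at which there is no admissible index\<close>
  define j' where "j' n = (if n \<ge> 3 then j n else 0)" for n
    have j': "j' n \<le> n" for n using j[of n] by (auto simp: j'_def)
    then have j'2: "j' n \<le> 2 * n" for n using le_trans[of "j' n" n "2 * n"] by simp
    have "(\<lambda>n. real n * (f n (n - 1 + j' n) - f n (j' n)) / f n (j' n)) \<longlonglongrightarrow> \<kappa> / (1 - p / 2)"
      unfolding \<kappa>_def using p2 by (intro tendsto_intros f_increment_tendsto f_tendsto j' j'2) auto
    moreover have "\<forall>\<^sub>F n in sequentially. real n * (f n (n - 1 + j' n) - f n (j' n)) / f n (j' n)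
        = real n * (f n (n - 1 + j n) / f n (j n) - 1)"
      using eventually_ge_at_top[of 8]
    proof eventually_elim
      case (elim n)
      then have "f n (j n) > 0" "j' n = j n" using j'2[of n] f_pos[of n "j n"] by (auto simp: j'_def)
      then show ?case by (simp add: field_simps)
    qed
    ultimately show "(\<lambda>n. real n * (f n (n - 1 + j n) / f n (j n) - 1)) \<longlonglongrightarrow> \<kappa> / (1 - p / 2)"
      by (rule Lim_transform_eventually)
  qed
  moreover have "(\<lambda>n. f n (n - 2)) \<longlonglongrightarrow> 1 - p / 2"
    by (rule f_tendsto) linarith
  ultimately have "(\<lambda>n. (\<Prod>i<n - 2. f n (n - 1 + i) / f n i) / f n (n - 2)) \<longlonglongrightarrow> exp (\<kappa> / (1 - p / 2)) / (1 - p / 2)"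
    using p2 by (intro tendsto_divide) auto
  moreover have "\<kappa> / (1 - p / 2) = - (2 * p * (1 - p) / (2 - p)\<^sup>2)"
    using p_le unfolding \<kappa>_def by (simp add: divide_simps power2_eq_square) (simp add: algebra_simps)
  moreover have "\<forall>\<^sub>F n in sequentially. (\<Prod>i<n - 2. f n (n - 1 + i) / f n i) / f n (n - 2) = F n (2 * n - 3) / (F n (n - 1))\<^sup>2"
    using eventually_ge_at_top[of 8]
  proof eventually_elim
    case (elim n)
    have "2 * n - 3 = n - 1 + (n - 2)" using elim by linarith
    then have num: "F n (2 * n - 3) = F n (n - 1) * (\<Prod>i<n - 2. f n (n - 1 + i))"
      using F_add[OF elim, of "n - 1" "n - 2"] by simp
    have "n - 1 = Suc (n - 2)" using elim by linarith
    then have den: "F n (n - 1) = (\<Prod>i<n - 2. f n i) * f n (n - 2)"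
      using F_eq_prod[OF elim] by simp
    have "F n (n - 1) > 0" using F_pos[OF elim] by simp
    then have "F n (2 * n - 3) / (F n (n - 1))\<^sup>2 = (\<Prod>i<n - 2. f n (n - 1 + i)) / F n (n - 1)"
      unfolding num by (simp add: power2_eq_square)
    then show ?case unfolding den by (simp add: prod_dividef)
  qed
  ultimately show ?thesis by (auto intro: Lim_transform_eventually)
qed

text \<open>
  Any constant below \<open>exp (-2)\<close> would do. The bound allows error estimates in powers of \<open>r\<close> to be
  compared with \<open>F n (n - 1)\<close>.
\<close>
lemma F_ge_power: "\<forall>\<^sub>F n in sequentially. exp (- 3) * r n ^ (n - 1) \<le> F n (n - 1)"
proof -
  have "(\<lambda>n. (1 - 2 / (real n - 2)) ^ (n - 1)) \<longlonglongrightarrow> exp (- 2)"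
    by real_asymp
  then have "\<forall>\<^sub>F n in sequentially. exp (- 3) < (1 - 2 / (real n - 2)) ^ (n - 1)"
    by (rule order_tendstoD) simp
  then show ?thesis using eventually_ge_at_top[of 8]
  proof eventually_elim
    case (elim n)
    have "(\<Prod>i<n - 1. r n * (1 - 2 / (real n - 2))) \<le> (\<Prod>i<n - 1. f n i)"
    proof (rule prod_mono, safe)
      fix i assume i: "i < n - 1"
      have less: "i < n choose 2" using slots_gt[OF elim(2)] i by linarith
      have D: "real ((n choose 2) - i) = real (n choose 2) - i" using less by (simp add: of_nat_diff)
      have ni: "real i \<le> real n - 1" using i by linarith
      have "(real n - 2) * i \<le> 2 * (real (n choose 2) - i)"
        using mult_left_mono[OF ni, of n] elim unfolding real_choose_two by (simp add: algebra_simps)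
      then have frac: "real i / real ((n choose 2) - i) \<le> 2 / (real n - 2)"
        using elim less unfolding D by (simp add: divide_simps mult.commute)
      have "q n / 2 * (1 + real i / real ((n choose 2) - i)) = m n / (2 * real ((n choose 2) - i))"
        using less elim(2) by (simp add: q_def of_nat_diff field_simps)
      then have "1 - q n / 2 * (1 + real i / real ((n choose 2) - i)) \<le> f n i"
        using avoid_ratio_ge[OF less m_le] unfolding f_def by simp
      moreover have "q n / 2 * (real i / real ((n choose 2) - i)) \<le> r n * (2 / (real n - 2))"
        using frac q_bounds[of n] r_bounds[of n] elim by (intro mult_mono) auto
      ultimately show "r n * (1 - 2 / (real n - 2)) \<le> f n i"
        unfolding r_def by (simp add: algebra_simps)
      show "0 \<le> r n * (1 - 2 / (real n - 2))"
        using r_bounds[of n] elim by (simp add: divide_le_eq)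
    qed
    also have "\<dots> = F n (n - 1)" using F_eq_prod[OF elim(2)] by simp
    finally have "r n ^ (n - 1) * (1 - 2 / (real n - 2)) ^ (n - 1) \<le> F n (n - 1)"
      by (simp add: power_mult_distrib)
    moreover have "r n ^ (n - 1) * exp (- 3) \<le> r n ^ (n - 1) * (1 - 2 / (real n - 2)) ^ (n - 1)"
      using elim(1) r_bounds[of n] by (intro mult_left_mono) auto
    ultimately show ?case by (simp add: mult.commute)
  qed
qed

end

section \<open>The critical equation\<close>


definition crit_fun :: "real \<Rightarrow> real" where
  "crit_fun p = 3 * exp (- (2 * p * (1 - p) / (2 - p)\<^sup>2)) - (4 - 2 * p)"

lemma crit_fun_deriv:
  assumes "p < 2"
  shows "(crit_fun has_real_derivative
     (2 - 3 * exp (- (2 * p * (1 - p) / (2 - p)\<^sup>2)) * ((4 - 6 * p) / (2 - p) ^ 3))) (at p)"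
proof -
  have eq: "(2 * (1 - p) - 2 * p) * (2 - p)\<^sup>2 + 2 * p * (1 - p) * (2 * (2 - p)) = (4 - 6 * p) * (2 - p)"
    by (simp add: power2_eq_square algebra_simps)
  have "((\<lambda>p. 2 * p * (1 - p) / (2 - p)\<^sup>2) has_real_derivative
      ((2 * (1 - p) - 2 * p) * (2 - p)\<^sup>2 + 2 * p * (1 - p) * (2 * (2 - p))) / ((2 - p)\<^sup>2 * (2 - p)\<^sup>2)) (at p)"
    using assms by (auto intro!: derivative_eq_intros) (simp add: algebra_simps)
  also have "((2 * (1 - p) - 2 * p) * (2 - p)\<^sup>2 + 2 * p * (1 - p) * (2 * (2 - p))) / ((2 - p)\<^sup>2 * (2 - p)\<^sup>2)
      = (4 - 6 * p) / (2 - p) ^ 3"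
    unfolding eq using assms by (simp add: divide_simps power2_eq_square power3_eq_cube)
  finally have g: "((\<lambda>p. 2 * p * (1 - p) / (2 - p)\<^sup>2) has_real_derivative (4 - 6 * p) / (2 - p) ^ 3) (at p)" .
  show ?thesis
    unfolding crit_fun_def by (rule derivative_eq_intros g refl)+ (simp add: algebra_simps)
qed

text \<open>
  Let \<open>g\<close> be the fraction in the exponent. On the unit interval \<open>g \<ge> 0\<close> and its derivative is at most
  \<open>1/2\<close>, so the derivative \<open>2 - 3 * exp (- g) * g'\<close> of \<open>crit_fun\<close> is at least \<open>1/2\<close>.
\<close>
lemma crit_fun_strict_mono:
  assumes "0 \<le> p" "p < q" "q \<le> 1"
  shows "crit_fun p < crit_fun q"
proof (rule DERIV_pos_imp_increasing[OF assms(2)])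
  fix x assume x: "p \<le> x" "x \<le> q"
  define E where "E = exp (- (2 * x * (1 - x) / (2 - x)\<^sup>2))"
  have E: "0 < E" "E \<le> 1" using x assms by (auto simp: E_def)
  have "(4 - 6 * x) / (2 - x) ^ 3 \<le> 1 / 2"
  proof -
    have "0 \<le> x\<^sup>2 * (6 - x)" using x assms by simp
    then have "2 * (4 - 6 * x) \<le> (2 - x) ^ 3" by (simp add: power3_eq_cube power2_eq_square algebra_simps)
    then show ?thesis using x assms by (simp add: divide_le_eq)
  qed
  then have "E * ((4 - 6 * x) / (2 - x) ^ 3) \<le> E * (1 / 2)" using E by (intro mult_left_mono) auto
  then have "2 - 3 * E * ((4 - 6 * x) / (2 - x) ^ 3) > 0" using E by linarith
  then show "\<exists>y. (crit_fun has_real_derivative y) (at x) \<and> y > 0"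
    using crit_fun_deriv[of x] x assms unfolding E_def by auto
qed

lemma exp_taylor_bounds:
  fixes x :: real
  assumes "0 \<le> x"
  shows "exp (- x) \<ge> 1 - x + x\<^sup>2 / 2 - x ^ 3 / 6"
    and "exp (- x) \<le> 1 - x + x\<^sup>2 / 2 - x ^ 3 / 6 + x ^ 4 / 24"
proof -
  obtain t where "exp (- x) = (\<Sum>m<4. (- x) ^ m / fact m) + exp t / fact 4 * (- x) ^ 4"
    using Maclaurin_exp_le[of "- x" 4] by blast
  moreover have "exp t / fact 4 * (- x) ^ 4 \<ge> 0" by simp
  moreover have "(\<Sum>m<4. (- x) ^ m / fact m) = 1 - x + x\<^sup>2 / 2 - x ^ 3 / 6"
    by (simp add: eval_nat_numeral field_simps)
  ultimately show "exp (- x) \<ge> 1 - x + x\<^sup>2 / 2 - x ^ 3 / 6" by linarith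
  obtain u where "exp (- x) = (\<Sum>m<5. (- x) ^ m / fact m) + exp u / fact 5 * (- x) ^ 5"
    using Maclaurin_exp_le[of "- x" 5] by blast
  moreover have "exp u / fact 5 * (- x) ^ 5 \<le> 0"
    using assms by (simp add: mult_nonneg_nonpos)
  moreover have "(\<Sum>m<5. (- x) ^ m / fact m) = 1 - x + x\<^sup>2 / 2 - x ^ 3 / 6 + x ^ 4 / 24"
    by (simp add: eval_nat_numeral field_simps)
  ultimately show "exp (- x) \<le> 1 - x + x\<^sup>2 / 2 - x ^ 3 / 6 + x ^ 4 / 24" by linarith
qed

text \<open>
  The root is near \<open>0.79929\<close>. At \<open>0.7986\<close> and \<open>0.7995\<close> the Taylor polynomials of degree four and three
  are still accurate enough to decide the sign.
\<close>
lemma crit_fun_lower: "crit_fun (7986/10000) < 0"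
proof -
  define x :: real where "x = 2 * (7986/10000) * (1 - 7986/10000) / (2 - 7986/10000)\<^sup>2"
  have x: "x \<ge> 0" by (simp add: x_def)
  have "1 - x + x\<^sup>2 / 2 - x ^ 3 / 6 + x ^ 4 / 24 < (4 - 2 * (7986/10000)) / 3"
    unfolding x_def by (simp add: eval_nat_numeral)
  then show ?thesis using exp_taylor_bounds(2)[OF x] unfolding crit_fun_def x_def[symmetric] by simp
qed

lemma crit_fun_upper: "crit_fun (7995/10000) > 0"
proof -
  define x :: real where "x = 2 * (7995/10000) * (1 - 7995/10000) / (2 - 7995/10000)\<^sup>2"
  have x: "x \<ge> 0" by (simp add: x_def)
  have "1 - x + x\<^sup>2 / 2 - x ^ 3 / 6 > (4 - 2 * (7995/10000)) / 3"
    unfolding x_def by (simp add: eval_nat_numeral)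
  then show ?thesis using exp_taylor_bounds(1)[OF x] unfolding crit_fun_def x_def[symmetric] by simp
qed

lemma critical_eq_iff: "critical_eq p \<longleftrightarrow> crit_fun p = 0"
  by (simp add: critical_eq_def crit_fun_def)

lemma critical_root: "\<exists>p. 7986/10000 < p \<and> p < 7995/10000 \<and> crit_fun p = 0"
proof -
  have "continuous_on {7986/10000..7995/10000} crit_fun"
    by (rule DERIV_atLeastAtMost_imp_continuous_on) (use crit_fun_deriv in force)
  then obtain p where p: "7986/10000 \<le> p" "p \<le> 7995/10000" "crit_fun p = 0"
    using IVT'[of crit_fun "7986/10000" 0 "7995/10000"] crit_fun_lower crit_fun_upper by auto
  moreover have "p \<noteq> 7986/10000" "p \<noteq> 7995/10000"
    using p(3) crit_fun_lower crit_fun_upper by (metis less_irrefl)+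
  ultimately show ?thesis by (intro exI[of _ p]) auto
qed

lemma critical_root_unique:
  assumes "p \<in> {0..1}" "q \<in> {0..1}" "crit_fun p = 0" "crit_fun q = 0"
  shows "p = q"
  using crit_fun_strict_mono[of p q] crit_fun_strict_mono[of q p] assms by force

lemma p_crit_root: "p_crit \<in> {0..1}" "crit_fun p_crit = 0" "\<bar>p_crit - 0.799\<bar> < 0.0005"
  and ex1_critical: "\<exists>!p. p \<in> {0..1} \<and> critical_eq p"
proof -
  obtain p where p: "7986/10000 < p" "p < 7995/10000" "crit_fun p = 0" using critical_root by blast
  show "\<exists>!p. p \<in> {0..1} \<and> critical_eq p"
    unfolding critical_eq_iff using p critical_root_unique by (intro ex1I[of _ p]) auto
  have "p_crit = p"
    unfolding p_crit_def critical_eq_iff using p critical_root_unique by (intro the_equality) auto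
  then show "p_crit \<in> {0..1}" "crit_fun p_crit = 0" "\<bar>p_crit - 0.799\<bar> < 0.0005"
    using p by (auto simp: abs_if)
qed

lemma crit_fun_sign:
  assumes "0 \<le> p" "p \<le> 1"
  shows "p < p_crit \<Longrightarrow> crit_fun p < 0" "p_crit < p \<Longrightarrow> crit_fun p > 0"
  using crit_fun_strict_mono[of p p_crit] crit_fun_strict_mono[of p_crit p] p_crit_root assms by auto

section \<open>The sign of the covariance\<close>


text \<open>
  A convex combination of \<open>t * (n - t) \<ge> (j + 1) * (n - j - 1)\<close> and \<open>t * (n - t) \<ge> t * n / 2\<close>, with weight
  \<open>1 / (2 * (j + 1))\<close> on the second. The first part exceeds \<open>j * n\<close> by about \<open>n / 2\<close>, and the second pays for
  the number \<open>n^t\<close> of sets of size \<open>t\<close>.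
\<close>
lemma cut_size_lower_bound:
  fixes t n j :: real
  assumes j: "0 \<le> j" and t: "j + 1 \<le> t" and n: "2 * t \<le> n"
  shows "t * (n - t) \<ge> j * (n - 1) + t * n / (4 * (j + 1)) + (n - (2 * j\<^sup>2 + j + 1)) / 2"
proof -
  define X where "X = t * (n - t)"
  define y where "y = 1 / (2 * (j + 1))"
  have y: "0 \<le> y" "y \<le> 1" "y * (2 * (j + 1)) = 1" using j by (auto simp: y_def)
  have "0 \<le> (t - (j + 1)) * (n - t - (j + 1))" using t n by (intro mult_nonneg_nonneg) auto
  then have "(j + 1) * (n - (j + 1)) \<le> X" by (simp add: X_def algebra_simps)
  then have 1: "(1 - y) * ((j + 1) * (n - (j + 1))) \<le> (1 - y) * X"
    using y by (intro mult_left_mono) auto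
  have "t * (n / 2) \<le> X" unfolding X_def using t n j by (intro mult_left_mono) auto
  then have 2: "y * (t * (n / 2)) \<le> y * X" using y by (intro mult_left_mono) auto
  have "(1 - y) * (j + 1) = j + 1 / 2" using y(3) by (simp add: algebra_simps)
  then have 3: "(1 - y) * ((j + 1) * (n - (j + 1))) = (j + 1 / 2) * (n - (j + 1))"
    by (simp only: mult.assoc[symmetric])
  have 4: "y * (t * (n / 2)) = t * n / (4 * (j + 1))"
    using j by (simp add: y_def)
  have 5: "(j + 1 / 2) * (n - (j + 1)) = j * (n - 1) + (n - (2 * j\<^sup>2 + j + 1)) / 2"
    by (simp add: power2_eq_square field_simps)
  have "(1 - y) * X + y * X = X" by (simp add: algebra_simps)
  then show ?thesis using 1 2 unfolding 3 4 5 X_def[symmetric] by linarith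
qed

context dense_edges
begin

abbreviation P :: "nat \<Rightarrow> (nat \<times> nat) set set \<Rightarrow> real" where
  "P n \<equiv> measure_pmf.prob (directed_gnm n (m n))"

lemma q_ge: "\<forall>\<^sub>F n in sequentially. p / 2 \<le> q n"
  using order_tendstoD(1)[OF density, of "p / 2"] p_pos unfolding q_def[symmetric]
  by (auto elim: eventually_mono)

lemma r_le_exp: "p / 2 \<le> q n \<Longrightarrow> r n \<le> exp (- (p / 4))"
  using exp_ge_add_one_self[of "- (q n / 2)"] by (auto simp: r_def intro: order.trans)

lemma r_power_le:
  assumes q: "p / 2 \<le> q n" and E: "k + D \<le> E"
  shows "r n ^ E \<le> exp (- (p / 4) * D) * r n ^ k"
proof -
  have r: "0 \<le> r n" "r n \<le> 1" using r_bounds[of n] by auto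
  have "r n ^ E \<le> r n ^ (k + D)" using r E by (intro power_decreasing) auto
  also have "\<dots> = r n ^ D * r n ^ k" by (simp add: power_add mult.commute)
  also have "\<dots> \<le> exp (- (p / 4)) ^ D * r n ^ k"
    using r r_le_exp[OF q] by (intro mult_right_mono power_mono) auto
  also have "exp (- (p / 4)) ^ D = exp (- (p / 4) * D)"
    by (simp add: exp_of_nat_mult[symmetric] mult.commute)
  finally show ?thesis .
qed

text \<open>
  An error of the size of \<open>r^(j * (n - 1))\<close> times a null sequence is negligible compared with the
  \<open>j\<close>-th power of the probability of being a sink.
\<close>
lemma negligible:
  assumes e: "\<forall>\<^sub>F n in sequentially. 0 \<le> e n \<and> e n \<le> g n * r n ^ (j * (n - 1))"
    and g: "g \<longlonglongrightarrow> 0"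
  shows "(\<lambda>n. e n / F n (n - 1) ^ j) \<longlonglongrightarrow> 0"
proof (rule tendsto_sandwich[of "\<lambda>_. 0"])
  have both: "\<forall>\<^sub>F n in sequentially. 0 \<le> e n / F n (n - 1) ^ j \<and> e n / F n (n - 1) ^ j \<le> g n * exp 3 ^ j"
    using e F_ge_power eventually_ge_at_top[of 8]
  proof eventually_elim
    case (elim n)
    have Fp: "F n (n - 1) > 0" using F_pos[of n "n - 1"] elim by simp
    have rp: "r n ^ (j * (n - 1)) > 0" using r_bounds[of n] by (intro zero_less_power) linarith
    have "0 \<le> g n * r n ^ (j * (n - 1))" using elim(1) by linarith
    then have gp: "0 \<le> g n" using rp by (simp add: zero_le_mult_iff)
    have "r n ^ (n - 1) = exp 3 * (exp (- 3) * r n ^ (n - 1))" by (simp add: exp_minus)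
    also have "\<dots> \<le> exp 3 * F n (n - 1)" using elim(2) by simp
    finally have "(r n ^ (n - 1)) ^ j \<le> (exp 3 * F n (n - 1)) ^ j"
      using r_bounds[of n] by (intro power_mono) auto
    then have "r n ^ (j * (n - 1)) \<le> exp 3 ^ j * F n (n - 1) ^ j"
      by (simp add: power_mult_distrib power_mult[symmetric] mult.commute)
    then have "g n * r n ^ (j * (n - 1)) \<le> g n * (exp 3 ^ j * F n (n - 1) ^ j)"
      using gp by (rule mult_left_mono)
    then have "e n \<le> g n * exp 3 ^ j * F n (n - 1) ^ j" using elim(1) by simp
    then show ?case using elim(1) Fp by (simp add: pos_divide_le_eq)
  qed
  then show "\<forall>\<^sub>F n in sequentially. 0 \<le> e n / F n (n - 1) ^ j"
    by eventually_elim (rule conjunct1)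
  from both show "\<forall>\<^sub>F n in sequentially. e n / F n (n - 1) ^ j \<le> g n * exp 3 ^ j"
    by eventually_elim (rule conjunct2)
  show "(\<lambda>n. g n * exp 3 ^ j) \<longlonglongrightarrow> 0"
    by (rule tendsto_mult_left_zero[OF g])
qed simp

text \<open>
  The number \<open>k\<close> enters only through the smaller of the two sides of the cut, \<open>t = min k (n - k)\<close>.
\<close>
lemma mid_closed_term_le:
  assumes q: "p / 2 \<le> q n" and n: "2 * j\<^sup>2 + j + 1 \<le> n"
    and decay: "real n * exp (- (p / 4) * (n / (4 * (real j + 1)))) \<le> 1"
    and k: "j < k" "k < n - j"
  shows "(n choose k) * r n ^ (k * (n - k))
    \<le> exp (- (p / 4) * ((n - (2 * (real j)\<^sup>2 + j + 1)) / 2)) * r n ^ (j * (n - 1))"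
proof -
  define t where "t = min k (n - k)"
  have kn: "k \<le> n" using k by linarith
  have t: "j + 1 \<le> t" "2 * t \<le> n" "k * (n - k) = t * (n - t)" "t \<le> n"
    using k by (auto simp: t_def min_def)
  have binom: "n choose k \<le> n ^ t"
    using binomial_le_pow[of k n] binomial_le_pow[of "n - k" n] binomial_symmetric[OF kn] kn
    by (auto simp: t_def min_def)
  have real_bound: "real t * (real n - real t) \<ge> real j * (real n - 1) + real t * real n / (4 * (real j + 1))
      + (real n - (2 * (real j)\<^sup>2 + real j + 1)) / 2"
    using t by (intro cut_size_lower_bound) auto
  have "real (2 * j\<^sup>2 + j + 1) \<le> real n" using n by (rule of_nat_mono)
  then have C: "(real n - (2 * (real j)\<^sup>2 + real j + 1)) / 2 \<ge> 0" by simp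
  have n1: "real (n - 1) = real n - 1" "real (n - t) = real n - real t" using n t by auto
  define D where "D = t * (n - t) - j * (n - 1)"
  have "real (j * (n - 1)) \<le> real (t * (n - t))"
  proof -
    have "0 \<le> real t * real n / (4 * (real j + 1))" by simp
    then show ?thesis using real_bound C unfolding of_nat_mult n1 by linarith
  qed
  then have le: "j * (n - 1) \<le> t * (n - t)" by (simp only: of_nat_le_iff)
  then have "real D = real t * (real n - real t) - real j * (real n - 1)"
    by (simp only: D_def of_nat_diff of_nat_mult n1)
  then have D: "real D \<ge> real t * (n / (4 * (real j + 1))) + (real n - (2 * (real j)\<^sup>2 + real j + 1)) / 2"
    using real_bound by simp
  have "r n ^ (k * (n - k)) \<le> exp (- (p / 4) * D) * r n ^ (j * (n - 1))"
    unfolding t(3) by (rule r_power_le[OF q]) (use le in \<open>simp add: D_def\<close>)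
  also have "\<dots> \<le> exp (- (p / 4) * (real t * (n / (4 * (real j + 1))) + (real n - (2 * (real j)\<^sup>2 + real j + 1)) / 2))
      * r n ^ (j * (n - 1))"
    using p_pos r_bounds[of n] D by (intro mult_right_mono) auto
  also have "exp (- (p / 4) * (real t * (n / (4 * (real j + 1))) + (real n - (2 * (real j)\<^sup>2 + real j + 1)) / 2))
      = exp (- (p / 4) * (n / (4 * (real j + 1)))) ^ t * exp (- (p / 4) * ((n - (2 * (real j)\<^sup>2 + j + 1)) / 2))"
    unfolding exp_of_nat_mult[symmetric] exp_add[symmetric] by (rule arg_cong[where f = exp]) (simp only: distrib_left mult.left_commute)
  finally have "real (n choose k) * r n ^ (k * (n - k)) \<le> real n ^ t *
      (exp (- (p / 4) * (n / (4 * (real j + 1)))) ^ t * exp (- (p / 4) * ((n - (2 * (real j)\<^sup>2 + j + 1)) / 2)) * r n ^ (j * (n - 1)))"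
    using binom r_bounds[of n] by (intro mult_mono) (auto simp flip: of_nat_power)
  also have "\<dots> = (real n * exp (- (p / 4) * (n / (4 * (real j + 1))))) ^ t *
      (exp (- (p / 4) * ((n - (2 * (real j)\<^sup>2 + j + 1)) / 2)) * r n ^ (j * (n - 1)))"
    by (simp only: power_mult_distrib mult.assoc)
  also have "\<dots> \<le> 1 * (exp (- (p / 4) * ((n - (2 * (real j)\<^sup>2 + j + 1)) / 2)) * r n ^ (j * (n - 1)))"
    using decay r_bounds[of n] by (intro mult_right_mono power_le_one) auto
  finally show ?thesis by simp
qed

lemma mid_closed_negligible: "(\<lambda>n. P n (mid_closed n j) / F n (n - 1) ^ j) \<longlonglongrightarrow> 0"
proof (rule negligible)
  have l: "p / 4 > 0" using p_pos by simp
  define C where "C = 2 * (real j)\<^sup>2 + j + 1"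
  define b where "b = 4 * (real j + 1)"
  have b: "b > 0" by (simp add: b_def)
  have lim: "(\<lambda>n. real n * exp (- l * (real n / b))) \<longlonglongrightarrow> 0" "(\<lambda>n. real n * exp (- l * ((real n - C) / 2))) \<longlonglongrightarrow> 0"
    if "l > 0" for l :: real
    using that b by real_asymp+
  show "(\<lambda>n. real n * exp (- (p / 4) * ((real n - C) / 2))) \<longlonglongrightarrow> 0" by (rule lim(2)[OF l])
  have "\<forall>\<^sub>F n in sequentially. real n * exp (- (p / 4) * (real n / b)) < 1"
    by (rule order_tendstoD(2)[OF lim(1)[OF l]]) simp
  then show "\<forall>\<^sub>F n in sequentially. 0 \<le> P n (mid_closed n j) \<and>
      P n (mid_closed n j) \<le> real n * exp (- (p / 4) * ((real n - C) / 2)) * r n ^ (j * (n - 1))"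
    using q_ge eventually_ge_at_top[of "2 * j\<^sup>2 + j + 1"]
  proof eventually_elim
    case (elim n)
    let ?B = "exp (- (p / 4) * ((real n - C) / 2)) * r n ^ (j * (n - 1))"
    have "P n (mid_closed n j) \<le> (\<Sum>k\<in>{j<..<n - j}. (n choose k) * r n ^ (k * (n - k)))"
      using prob_mid_closed_le[OF m_le[of n], of j] unfolding r_eq .
    also have "\<dots> \<le> (\<Sum>k\<in>{j<..<n - j}. ?B)"
      using elim unfolding C_def b_def by (intro sum_mono mid_closed_term_le) auto
    also have "\<dots> = real (card {j<..<n - j}) * ?B" by simp
    also have "\<dots> \<le> real n * ?B"
      using r_bounds[of n] by (intro mult_right_mono) auto
    finally show ?case by simp
  qed
qed

text \<open>
  The exponent \<open>3 * (n - 4)\<close> exceeds \<open>2 * (n - 1)\<close> by \<open>n - 10\<close>.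
\<close>
lemma small_pair_negligible: "(\<lambda>n. P n (small_pair n) / F n (n - 1) ^ 2) \<longlonglongrightarrow> 0"
proof (rule negligible)
  have "(\<lambda>n. real n ^ 4 * exp (- l * (real n - 10))) \<longlonglongrightarrow> 0" if "l > 0" for l :: real
    using that by real_asymp
  from this[of "p / 4"] show "(\<lambda>n. real n ^ 4 * exp (- (p / 4) * (real n - 10))) \<longlonglongrightarrow> 0" using p_pos by simp
  show "\<forall>\<^sub>F n in sequentially. 0 \<le> P n (small_pair n) \<and>
      P n (small_pair n) \<le> real n ^ 4 * exp (- (p / 4) * (real n - 10)) * r n ^ (2 * (n - 1))"
    using q_ge eventually_ge_at_top[of 10]
  proof eventually_elim
    case (elim n)
    have "r n ^ (3 * (n - 4)) \<le> exp (- (p / 4) * real (n - 10)) * r n ^ (2 * (n - 1))"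
      by (rule r_power_le[OF elim(1)]) (use elim in linarith)
    then have "real n ^ 4 * r n ^ (3 * (n - 4)) \<le> real n ^ 4 * (exp (- (p / 4) * (real n - 10)) * r n ^ (2 * (n - 1)))"
      using elim(2) by (intro mult_left_mono) (auto simp: of_nat_diff)
    then show ?case using prob_small_pair_le[OF m_le[of n]] unfolding r_eq by simp
  qed
qed

lemma r_power_negligible:
  assumes E: "\<forall>\<^sub>F n in sequentially. j * (n - 1) + (n - c) \<le> E n"
  shows "(\<lambda>n. r n ^ E n / F n (n - 1) ^ j) \<longlonglongrightarrow> 0"
proof (rule negligible)
  have "(\<lambda>n. exp (- l * (real n - real c))) \<longlonglongrightarrow> 0" if "l > 0" for l :: real
    using that by real_asymp
  from this[of "p / 4"] show "(\<lambda>n. exp (- (p / 4) * (real n - real c))) \<longlonglongrightarrow> 0" using p_pos by simp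
  show "\<forall>\<^sub>F n in sequentially. 0 \<le> r n ^ E n \<and> r n ^ E n \<le> exp (- (p / 4) * (real n - real c)) * r n ^ (j * (n - 1))"
    using q_ge E eventually_ge_at_top[of c]
  proof eventually_elim
    case (elim n)
    then show ?case using r_power_le[OF elim(1,2)] r_bounds[of n] by (simp add: of_nat_diff)
  qed
qed

text \<open>
  One has \<open>1 - q \<le> (1 - q^2/4) * r^2\<close>, and the first factor is at most \<open>exp (- p^2/16)\<close> as soon as
  \<open>q \<ge> p/2\<close>.
\<close>
lemma isolated_negligible: "(\<lambda>n. (1 - q n) ^ (n - 1) / F n (n - 1) ^ 2) \<longlonglongrightarrow> 0"
proof (rule negligible)
  have "(\<lambda>n. exp (- l) ^ (n - 1)) \<longlonglongrightarrow> 0" if "l > 0" for l :: real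
    using that by real_asymp
  from this[of "p\<^sup>2 / 16"] show "(\<lambda>n. exp (- (p\<^sup>2 / 16)) ^ (n - 1)) \<longlonglongrightarrow> 0" using p_pos by simp
  show "\<forall>\<^sub>F n in sequentially. 0 \<le> (1 - q n) ^ (n - 1) \<and>
      (1 - q n) ^ (n - 1) \<le> exp (- (p\<^sup>2 / 16)) ^ (n - 1) * r n ^ (2 * (n - 1))"
    using q_ge
  proof eventually_elim
    case (elim n)
    have "(r n)\<^sup>2 * (q n)\<^sup>2 \<le> 1 * (q n)\<^sup>2" using r_bounds[of n] by (intro mult_right_mono power_le_one) auto
    then have "1 - q n \<le> (1 - (q n)\<^sup>2 / 4) * (r n)\<^sup>2"
      by (simp add: r_def power2_eq_square algebra_simps)
    also have "1 - (q n)\<^sup>2 / 4 \<le> exp (- ((q n)\<^sup>2 / 4))"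
      using exp_ge_add_one_self[of "- ((q n)\<^sup>2 / 4)"] by simp
    also have "\<dots> \<le> exp (- (p\<^sup>2 / 16))"
      using power_mono[OF elim, of 2] p_pos by (simp add: power_divide)
    finally have "1 - q n \<le> exp (- (p\<^sup>2 / 16)) * (r n)\<^sup>2" by (simp add: mult_right_mono)
    then have "(1 - q n) ^ (n - 1) \<le> (exp (- (p\<^sup>2 / 16)) * (r n)\<^sup>2) ^ (n - 1)"
      using q_bounds[of n] by (intro power_mono) auto
    then show ?case using q_bounds[of n] by (simp add: power_mult_distrib power_mult)
  qed
qed

text \<open>
  Bounds for the covariance that do not depend on the three vertices. Divided by the square of the
  sink probability, both have the limit \<open>limit_cov\<close>, in which \<open>3\<close> counts the dominant configurations of
  the joint event and \<open>4\<close> comes from two configurations for each single event.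
\<close>
definition cov_upper :: "nat \<Rightarrow> real" where
  "cov_upper n = (3 * F n (2 * n - 3) + P n (mid_closed n 2) + P n (small_pair n) + (1 - q n) ^ (n - 1))
     - (2 * F n (n - 1) - r n ^ (2 * (n - 2)))\<^sup>2"

definition cov_lower :: "nat \<Rightarrow> real" where
  "cov_lower n = (3 * F n (2 * n - 3) - 3 * r n ^ (3 * (n - 3))) - (2 * F n (n - 1) + P n (mid_closed n 1))\<^sup>2"

definition limit_cov :: real where
  "limit_cov = 3 * (exp (- (2 * p * (1 - p) / (2 - p)\<^sup>2)) / (1 - p / 2)) - 4"

lemma limit_cov_eq: "limit_cov = crit_fun p / (1 - p / 2)"
  using p_le by (simp add: limit_cov_def crit_fun_def field_simps)

lemma single_negligible:
  "(\<lambda>n. r n ^ (2 * (n - 2)) / F n (n - 1)) \<longlonglongrightarrow> 0"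
  "(\<lambda>n. P n (mid_closed n 1) / F n (n - 1)) \<longlonglongrightarrow> 0"
proof -
  have "\<forall>\<^sub>F n in sequentially. 1 * (n - 1) + (n - 3) \<le> 2 * (n - (2::nat))"
    using eventually_ge_at_top[of 3] by eventually_elim linarith
  from r_power_negligible[OF this] show "(\<lambda>n. r n ^ (2 * (n - 2)) / F n (n - 1)) \<longlonglongrightarrow> 0" by simp
  from mid_closed_negligible[of 1] show "(\<lambda>n. P n (mid_closed n 1) / F n (n - 1)) \<longlonglongrightarrow> 0" by simp
qed

lemma cov_upper_tendsto: "(\<lambda>n. cov_upper n / F n (n - 1) ^ 2) \<longlonglongrightarrow> limit_cov"
proof -
  have "(\<lambda>n. (3 * (F n (2 * n - 3) / F n (n - 1) ^ 2) + P n (mid_closed n 2) / F n (n - 1) ^ 2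
      + P n (small_pair n) / F n (n - 1) ^ 2 + (1 - q n) ^ (n - 1) / F n (n - 1) ^ 2)
      - (2 - r n ^ (2 * (n - 2)) / F n (n - 1))\<^sup>2)
    \<longlonglongrightarrow> (3 * (exp (- (2 * p * (1 - p) / (2 - p)\<^sup>2)) / (1 - p / 2)) + 0 + 0 + 0) - (2 - 0)\<^sup>2"
    by (intro tendsto_intros F_ratio_tendsto mid_closed_negligible small_pair_negligible isolated_negligible
        single_negligible)
  then have "(\<lambda>n. (3 * (F n (2 * n - 3) / F n (n - 1) ^ 2) + P n (mid_closed n 2) / F n (n - 1) ^ 2
      + P n (small_pair n) / F n (n - 1) ^ 2 + (1 - q n) ^ (n - 1) / F n (n - 1) ^ 2)
      - (2 - r n ^ (2 * (n - 2)) / F n (n - 1))\<^sup>2) \<longlonglongrightarrow> limit_cov" by (simp add: limit_cov_def)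
  moreover have "\<forall>\<^sub>F n in sequentially. (3 * (F n (2 * n - 3) / F n (n - 1) ^ 2) + P n (mid_closed n 2) / F n (n - 1) ^ 2
      + P n (small_pair n) / F n (n - 1) ^ 2 + (1 - q n) ^ (n - 1) / F n (n - 1) ^ 2)
      - (2 - r n ^ (2 * (n - 2)) / F n (n - 1))\<^sup>2 = cov_upper n / F n (n - 1) ^ 2"
    using eventually_ge_at_top[of 8]
  proof eventually_elim
    case (elim n)
    have Fp: "F n (n - 1) > 0" using F_pos[of n "n - 1"] elim by simp
    have "2 - r n ^ (2 * (n - 2)) / F n (n - 1) = (2 * F n (n - 1) - r n ^ (2 * (n - 2))) / F n (n - 1)"
      using Fp by (simp add: diff_divide_distrib)
    then have "(2 - r n ^ (2 * (n - 2)) / F n (n - 1))\<^sup>2 = (2 * F n (n - 1) - r n ^ (2 * (n - 2)))\<^sup>2 / (F n (n - 1))\<^sup>2"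
      by (simp only: power_divide)
    then show ?case unfolding cov_upper_def
      by (simp only: diff_divide_distrib add_divide_distrib times_divide_eq_right)
  qed
  ultimately show ?thesis by (rule Lim_transform_eventually)
qed

lemma cov_lower_tendsto: "(\<lambda>n. cov_lower n / F n (n - 1) ^ 2) \<longlonglongrightarrow> limit_cov"
proof -
  have "\<forall>\<^sub>F n in sequentially. 2 * (n - 1) + (n - 7) \<le> 3 * (n - (3::nat))"
    using eventually_ge_at_top[of 7] by eventually_elim linarith
  note pairs = r_power_negligible[OF this]
  have "(\<lambda>n. (3 * (F n (2 * n - 3) / F n (n - 1) ^ 2) - 3 * (r n ^ (3 * (n - 3)) / F n (n - 1) ^ 2))
      - (2 + P n (mid_closed n 1) / F n (n - 1))\<^sup>2)
    \<longlonglongrightarrow> (3 * (exp (- (2 * p * (1 - p) / (2 - p)\<^sup>2)) / (1 - p / 2)) - 3 * 0) - (2 + 0)\<^sup>2"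
    by (intro tendsto_intros F_ratio_tendsto pairs single_negligible)
  then have "(\<lambda>n. (3 * (F n (2 * n - 3) / F n (n - 1) ^ 2) - 3 * (r n ^ (3 * (n - 3)) / F n (n - 1) ^ 2))
      - (2 + P n (mid_closed n 1) / F n (n - 1))\<^sup>2) \<longlonglongrightarrow> limit_cov" by (simp add: limit_cov_def)
  moreover have "\<forall>\<^sub>F n in sequentially. (3 * (F n (2 * n - 3) / F n (n - 1) ^ 2) - 3 * (r n ^ (3 * (n - 3)) / F n (n - 1) ^ 2))
      - (2 + P n (mid_closed n 1) / F n (n - 1))\<^sup>2 = cov_lower n / F n (n - 1) ^ 2"
    using eventually_ge_at_top[of 8]
  proof eventually_elim
    case (elim n)
    have Fp: "F n (n - 1) > 0" using F_pos[of n "n - 1"] elim by simp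
    have "2 + P n (mid_closed n 1) / F n (n - 1) = (2 * F n (n - 1) + P n (mid_closed n 1)) / F n (n - 1)"
      using Fp by (simp add: add_divide_distrib)
    then have "(2 + P n (mid_closed n 1) / F n (n - 1))\<^sup>2 = (2 * F n (n - 1) + P n (mid_closed n 1))\<^sup>2 / (F n (n - 1))\<^sup>2"
      by (simp only: power_divide)
    then show ?case unfolding cov_lower_def
      by (simp only: diff_divide_distrib add_divide_distrib times_divide_eq_right)
  qed
  ultimately show ?thesis by (rule Lim_transform_eventually)
qed

lemma event_cov_bounds:
  "\<forall>\<^sub>F n in sequentially. \<forall>s\<in>{1..n}. \<forall>a\<in>{1..n}. \<forall>b\<in>{1..n}. distinct [s, a, b] \<longrightarrow>
     cov_lower n \<le> event_cov (directed_gnm n (m n)) (no_path_event s a) (no_path_event b s) \<and>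
     event_cov (directed_gnm n (m n)) (no_path_event s a) (no_path_event b s) \<le> cov_upper n"
proof -
  have "\<forall>\<^sub>F n in sequentially. r n ^ (2 * (n - 2)) / F n (n - 1) < 2"
    by (rule order_tendstoD(2)[OF single_negligible(1)]) simp
  then show ?thesis using eventually_ge_at_top[of 8]
  proof eventually_elim
    case (elim n)
    have Fp: "F n (n - 1) > 0" using F_pos[of n "n - 1"] elim by simp
    show ?case
    proof (intro ballI impI)
      fix s a b assume V: "s \<in> {1..n}" "a \<in> {1..n}" "b \<in> {1..n}" and dist: "distinct [s, a, b]"
      let ?A = "no_path_event s a" and ?B = "no_path_event b s"
      have lo: "2 * F n (n - 1) - r n ^ (2 * (n - 2)) \<le> P n ?A" "2 * F n (n - 1) - r n ^ (2 * (n - 2)) \<le> P n ?B"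
        using prob_no_path_lower[OF m_le[of n], of s a] prob_no_path_lower[OF m_le[of n], of b s] V dist
        unfolding r_eq F_def by auto
      have up: "P n ?A \<le> 2 * F n (n - 1) + P n (mid_closed n 1)" "P n ?B \<le> 2 * F n (n - 1) + P n (mid_closed n 1)"
        using prob_no_path_upper[OF m_le[of n], of s a] prob_no_path_upper[OF m_le[of n], of b s] V
        unfolding F_def by auto
      have pos: "0 \<le> 2 * F n (n - 1) - r n ^ (2 * (n - 2))"
        using elim(1) Fp by (simp add: pos_divide_less_eq)
      have prod_lo: "(2 * F n (n - 1) - r n ^ (2 * (n - 2)))\<^sup>2 \<le> P n ?A * P n ?B"
        unfolding power2_eq_square using lo pos by (intro mult_mono) auto
      have prod_up: "P n ?A * P n ?B \<le> (2 * F n (n - 1) + P n (mid_closed n 1))\<^sup>2"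
        unfolding power2_eq_square using up Fp by (intro mult_mono) auto
      have "3 * F n (2 * n - 3) - 3 * r n ^ (3 * (n - 3)) \<le> P n (?A \<inter> ?B)"
        using prob_no_paths_lower[OF m_le V dist] unfolding r_eq F_def .
      moreover have "P n (?A \<inter> ?B) \<le> 3 * F n (2 * n - 3) + P n (mid_closed n 2) + P n (small_pair n) + (1 - q n) ^ (n - 1)"
        using prob_no_paths_upper[OF m_le _ V dist] elim(2) unfolding F_def q_def by simp
      ultimately show "cov_lower n \<le> event_cov (directed_gnm n (m n)) ?A ?B \<and>
          event_cov (directed_gnm n (m n)) ?A ?B \<le> cov_upper n"
        using prod_lo prod_up unfolding event_cov_def cov_lower_def cov_upper_def by linarith
    qed
  qed
qed

lemma event_cov_sign:
  "\<forall>\<^sub>F n in sequentially. \<forall>s\<in>{1..n}. \<forall>a\<in>{1..n}. \<forall>b\<in>{1..n}. distinct [s, a, b] \<longrightarrow>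
     (p < p_crit \<longrightarrow> event_cov (directed_gnm n (m n)) (no_path_event s a) (no_path_event b s) < 0) \<and>
     (p_crit < p \<longrightarrow> event_cov (directed_gnm n (m n)) (no_path_event s a) (no_path_event b s) > 0)"
proof -
  have p2: "1 - p / 2 > 0" using p_le by simp
  have neg: "\<forall>\<^sub>F n in sequentially. p < p_crit \<longrightarrow> cov_upper n / F n (n - 1) ^ 2 < 0"
  proof (cases "p < p_crit")
    case True
    then have "limit_cov < 0" unfolding limit_cov_eq
      using crit_fun_sign(1)[of p] p_pos p_le p2 by (simp add: divide_neg_pos)
    then show ?thesis using order_tendstoD(2)[OF cov_upper_tendsto] by (auto elim: eventually_mono)
  qed simp
  have pos: "\<forall>\<^sub>F n in sequentially. p_crit < p \<longrightarrow> 0 < cov_lower n / F n (n - 1) ^ 2"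
  proof (cases "p_crit < p")
    case True
    then have "0 < limit_cov" unfolding limit_cov_eq
      using crit_fun_sign(2)[of p] p_pos p_le p2 by simp
    then show ?thesis using order_tendstoD(1)[OF cov_lower_tendsto] by (auto elim: eventually_mono)
  qed simp
  show ?thesis
    using neg pos event_cov_bounds eventually_ge_at_top[of 8]
  proof eventually_elim
    case (elim n)
    have "F n (n - 1) > 0" using F_pos[of n "n - 1"] elim(4) by simp
    then have Fp: "F n (n - 1) ^ 2 > 0" by simp
    have "p < p_crit \<Longrightarrow> cov_upper n < 0"
      using elim(1) unfolding pos_divide_less_eq[OF Fp] by simp
    moreover have "p_crit < p \<Longrightarrow> cov_lower n > 0"
      using elim(2) unfolding pos_less_divide_eq[OF Fp] by simp
    ultimately show ?case using elim(3) by (meson le_less_trans less_le_trans)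
  qed
qed

end

theorem theorem2p2:
  "(\<exists>!p. p \<in> {0..1} \<and> critical_eq p)
   \<and> \<bar>p_crit - 0.799\<bar> < 0.0005
   \<and> (\<forall>(m :: nat \<Rightarrow> nat) (p :: real).
        (\<forall>n. m n \<le> n choose 2) \<longrightarrow>
        filterlim m at_top sequentially \<longrightarrow>
        (\<lambda>n. real (m n) / real (n choose 2)) \<longlonglongrightarrow> p \<longrightarrow>
        0 < p \<longrightarrow> p \<le> 1 \<longrightarrow>
        (\<forall>\<^sub>F n in sequentially.
           \<forall>s\<in>{1..n}. \<forall>a\<in>{1..n}. \<forall>b\<in>{1..n}. distinct [s, a, b] \<longrightarrow>
             (0 < p \<and> p < p_crit \<longrightarrow>
                event_cov (directed_gnm n (m n)) (no_path_event s a) (no_path_event b s) < 0) \<and>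
             (p_crit < p \<and> p \<le> 1 \<longrightarrow>
                event_cov (directed_gnm n (m n)) (no_path_event s a) (no_path_event b s) > 0)))"
proof (intro conjI allI impI)
  show "\<exists>!p. p \<in> {0..1} \<and> critical_eq p" by (rule ex1_critical)
  show "\<bar>p_crit - 0.799\<bar> < 0.0005" by (rule p_crit_root)
  fix m :: "nat \<Rightarrow> nat" and p :: real
  assume "\<forall>n. m n \<le> n choose 2" "(\<lambda>n. real (m n) / real (n choose 2)) \<longlonglongrightarrow> p" "0 < p" "p \<le> 1"
  then interpret dense_edges m p by unfold_locales auto
  show "\<forall>\<^sub>F n in sequentially.
           \<forall>s\<in>{1..n}. \<forall>a\<in>{1..n}. \<forall>b\<in>{1..n}. distinct [s, a, b] \<longrightarrow>
             (0 < p \<and> p < p_crit \<longrightarrow>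
                event_cov (directed_gnm n (m n)) (no_path_event s a) (no_path_event b s) < 0) \<and>
             (p_crit < p \<and> p \<le> 1 \<longrightarrow>
                event_cov (directed_gnm n (m n)) (no_path_event s a) (no_path_event b s) > 0)"
    using event_cov_sign by (rule eventually_mono) blast
qed

end
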